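(* For each $n=1,\ldots,N$ such that station $n$ is stable, given the distribution of $S^{(n)}$ and the probability generating function $Y(z)$ of $Y^{(n)}$, the mean and variance of the steady state queue length $Q^{(n)}$ are $$\mathbb{E}[Q^{(n)}]=\frac{\overline{\overline S}^{(n)}+\overline{\overline Y}^{(n)}+(\overline S^{(n)}-\overline Y^{(n)})\left[1+2(\overline S^{(n)}-C)\right]-(\overline S^{(n)}-\overline Y^{(n)})^2}{2(\overline S^{(n)}-\overline Y^{(n)})}+\sum_{i=1}^{C-1}\frac{1}{1-z_i^*},$$ $$\begin{aligned}\operatorname{Var}[Q^{(n)}]=\ &\frac{1}{12(\overline S^{(n)}-\overline Y^{(n)})^2}\Big[-4(\overline{\overline{\overline S}}^{(n)}-\overline{\overline{\overline Y}}^{(n)})(\overline S^{(n)}-\overline Y^{(n)})+3(\overline{\overline S}^{(n)}+\overline{\overline Y}^{(n)})^2\\&-\left[6(\overline{\overline S}^{(n)}-\overline{\overline Y}^{(n)})-1\right](\overline S^{(n)}-\overline Y^{(n)})^2-(\overline S^{(n)}-\overline Y^{(n)})^4\Big]-\sum_{i=1}^{C-1}\frac{z_i^*}{(1-z_i^* )^2},\end{aligned}$$ where $z_0^*=1,z_1^*,\ldots,z_{C-1}^*$ are the roots in the closed unit disk, listed according to multiplicity, of $\mathcal{F}^{(n)}(z)=z^{C}-Y(z)\sum_{u=0}^{C}s_u^{(n)}z^{C-u}$.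
   Context: For $X\in\{S,Y\}$, $\overline X^{(n)}$, $\overline{\overline X}^{(n)}$ and $\overline{\overline{\overline X}}^{(n)}$ denote the mean, the second central moment (variance) and the third central moment of $X^{(n)}$. Station model (bulk service queue) with integer vehicle capacity $C\ge1$. $Q^{(n,l)}$ is the number of passengers waiting at station $n$ when vehicle $l$ arrives; $S^{(n,l)}\in\{0,\ldots,C\}$ is the available space of vehicle $l$; $R^{(n,l)}=\max\{0,Q^{(n,l)}-S^{(n,l)}\}$ is the number left behind; and $Q^{(n,l+1)}=R^{(n,l)}+Y^{(n,l)}$, where $Y^{(n,l)}$ is the number of Poisson arrivals (rate $\lambda^{(n)}\ge0$) in the headway following vehicle $l$; conditional on a headway of length $h\ge0$, it is Poisson with mean $\lambda^{(n)}h$. The $S^{(n,l)}$ are i.i.d. with distribution $s^{(n)}=[s_0^{(n)},\ldots,s_C^{(n)}]$ (generic variable $S^{(n)}$), independent of headways, local arrivals and local queue history. Headways are nonnegative, i.i.d., each independent of all prior headways and of prior queue and load states; hence the $Y^{(n,l)}$ are i.i.d. (generic variable $Y^{(n)}$) and $Y^{(n,l)}$ is independent of $R^{(n,l)}$. (The common headway law is that of $\max\{0,\widehat H\}$ with $\widehat H=\overline H+\frac{2\gamma T^{(N)}}{\theta\overline F}+I-I'$, where $I,I'$ are i.i.d. sums of a Poisson($\gamma T^{(n)}$) number of independent exponential($\theta$) variables, or its approximation in which $\widehat H$ is replaced by a normal variable with the same mean and variance; $\overline H,\overline F,\theta,T^{(n)},T^{(N)}>0$, $\gamma\ge0$ are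 constants.) Stability means that the queue process has a proper stationary distribution, which here is equivalent to $\overline Y^{(n)}<\overline S^{(n)}$; $Q^{(n)}$ has the steady state distribution of $Q^{(n,l)}$. Under these conditions $\mathcal{F}^{(n)}$ has exactly $C$ roots in the closed unit disk counted with multiplicity, and $z=1$ is a simple root. *)

theory Defs
  imports "HOL-Probability.Probability" "HOL-Complex_Analysis.Complex_Analysis"
begin

(* The library's poisson_pmf is only specified for strictly positive rates, whereas rate 0 has to be
   allowed here; since 0 ^ 0 = 1, the formula below gives the point mass at 0 in that case. *)
definition poisson_prob :: "real \<Rightarrow> nat \<Rightarrow> real" where
  "poisson_prob r k = r ^ k / fact k * exp (- r)"

definition poisson_law :: "real \<Rightarrow> nat measure" where
  "poisson_law r = density (count_space UNIV) (\<lambda>k. ennreal (poisson_prob r k))"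

definition exponential_law :: "real \<Rightarrow> real measure" where
  "exponential_law \<theta> = density lborel (\<lambda>x. ennreal (exponential_density \<theta> x))"

(* Law of the sum of the first K members of an i.i.d. exponential sequence, where K is Poisson and
   independent of the sequence. *)
definition compound_law :: "real \<Rightarrow> real \<Rightarrow> real measure" where
  "compound_law r \<theta> =
     distr (poisson_law r \<Otimes>\<^sub>M (\<Pi>\<^sub>M i\<in>(UNIV :: nat set). exponential_law \<theta>)) borel
       (\<lambda>(k, x). \<Sum>i<k. x i)"

(* Law of Hbar + 2 gamma T_N / (theta Fbar) + I - I', where I and I' are independent with law
   compound_law (gamma T_n) theta. *)
definition raw_headway_law ::
    "real \<Rightarrow> real \<Rightarrow> real \<Rightarrow> real \<Rightarrow> real \<Rightarrow> real \<Rightarrow> real measure" where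
  "raw_headway_law Hbar Fbar \<theta> \<gamma> Tn TN =
     distr (compound_law (\<gamma> * Tn) \<theta> \<Otimes>\<^sub>M compound_law (\<gamma> * Tn) \<theta>) borel
       (\<lambda>(a, b). Hbar + 2 * \<gamma> * TN / (\<theta> * Fbar) + a - b)"

definition mean :: "'a measure \<Rightarrow> ('a \<Rightarrow> real) \<Rightarrow> real" where
  "mean M X = (\<integral>x. X x \<partial>M)"

definition central_moment :: "'a measure \<Rightarrow> nat \<Rightarrow> ('a \<Rightarrow> real) \<Rightarrow> real" where
  "central_moment M k X = (\<integral>x. (X x - mean M X) ^ k \<partial>M)"

(* The variance v is 0 when gamma = 0; the normal law is then the point mass at its mean. *)
definition normal_law :: "real \<Rightarrow> real \<Rightarrow> real measure" where
  "normal_law m v =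
     (if v = 0 then return borel m
      else density lborel (\<lambda>x. ennreal (normal_density m (sqrt v) x)))"

definition headway_law ::
    "real \<Rightarrow> real \<Rightarrow> real \<Rightarrow> real \<Rightarrow> real \<Rightarrow> real \<Rightarrow> real measure" where
  "headway_law Hbar Fbar \<theta> \<gamma> Tn TN =
     distr (raw_headway_law Hbar Fbar \<theta> \<gamma> Tn TN) borel (\<lambda>h. max 0 h)"

definition normal_headway_law ::
    "real \<Rightarrow> real \<Rightarrow> real \<Rightarrow> real \<Rightarrow> real \<Rightarrow> real \<Rightarrow> real measure" where
  "normal_headway_law Hbar Fbar \<theta> \<gamma> Tn TN =
     (let L = raw_headway_law Hbar Fbar \<theta> \<gamma> Tn TN
      in distr (normal_law (mean L (\<lambda>h. h)) (central_moment L 2 (\<lambda>h. h))) borel (\<lambda>h. max 0 h))"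

datatype source = Initial | Space nat | Arrivals nat

(* The sigma-algebras generated by the initial queue Q 0, by S l and by the pair (H l, Y l).
   Their mutual independence (assumed below) expresses all independence properties of the model:
   Q l, S l and (H l, Y l) are then independent for each l, because Q l is a function of the
   initial queue and of the sources with index less than l. *)
definition source_events ::
    "'a measure \<Rightarrow> (nat \<Rightarrow> 'a \<Rightarrow> nat) \<Rightarrow> (nat \<Rightarrow> 'a \<Rightarrow> real) \<Rightarrow> (nat \<Rightarrow> 'a \<Rightarrow> nat) \<Rightarrow>
       (nat \<Rightarrow> 'a \<Rightarrow> nat) \<Rightarrow> source \<Rightarrow> 'a set set" where
  "source_events M S H Y Q i =
     (case i of
        Initial \<Rightarrow> {Q 0 -` A \<inter> space M | A. A \<in> sets (count_space UNIV)}
      | Space l \<Rightarrow> {S l -` A \<inter> space M | A. A \<in> sets (count_space UNIV)}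
      | Arrivals l \<Rightarrow> {(\<lambda>\<omega>. (H l \<omega>, Y l \<omega>)) -` A \<inter> space M | A.
                        A \<in> sets (borel \<Otimes>\<^sub>M count_space UNIV)})"

locale station_queue = prob_space M for M :: "'a measure" +
  fixes C :: nat                            (* vehicle capacity *)
    and lam :: real                         (* arrival rate *)
    and s :: "nat pmf"                      (* distribution of the available space *)
    and hw :: "real measure"                (* common law of the headways *)
    and S :: "nat \<Rightarrow> 'a \<Rightarrow> nat"
    and H :: "nat \<Rightarrow> 'a \<Rightarrow> real"
    and Y :: "nat \<Rightarrow> 'a \<Rightarrow> nat"
    and Q :: "nat \<Rightarrow> 'a \<Rightarrow> nat"
  assumes capacity: "C \<ge> 1"
    and rate: "lam \<ge> 0"
    and space_range: "set_pmf s \<subseteq> {..C}"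
    and S_measurable: "\<And>l. S l \<in> measurable M (count_space UNIV)"
    and H_measurable: "\<And>l. H l \<in> borel_measurable M"
    and Y_measurable: "\<And>l. Y l \<in> measurable M (count_space UNIV)"
    and Q0_measurable: "Q 0 \<in> measurable M (count_space UNIV)"
    and S_law: "\<And>l. distr M (count_space UNIV) (S l) = measure_pmf s"
    and H_law: "\<And>l. distr M borel (H l) = hw"
    (* Conditionally on H l = h, the variable Y l is Poisson with mean lam * h. *)
    and Y_law: "\<And>l A k. A \<in> sets borel \<Longrightarrow>
        measure M {\<omega> \<in> space M. H l \<omega> \<in> A \<and> Y l \<omega> = k}
          = (\<integral>h. indicator A h * poisson_prob (lam * h) k \<partial>hw)"
    and independence: "indep_sets (source_events M S H Y Q) UNIV"
    (* Truncated subtraction: Q l - S l is the number max 0 (Q l - S l) of passengers left behind. *)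
    and Q_Suc: "\<And>l \<omega>. \<omega> \<in> space M \<Longrightarrow> Q (Suc l) \<omega> = (Q l \<omega> - S l \<omega>) + Y l \<omega>"

(* Transition probabilities of the queue process. The variables S 0 and Y 0 represent the i.i.d.
   sequences S l and Y l here and below. *)
definition queue_transition ::
    "'a measure \<Rightarrow> (nat \<Rightarrow> 'a \<Rightarrow> nat) \<Rightarrow> (nat \<Rightarrow> 'a \<Rightarrow> nat) \<Rightarrow> nat \<Rightarrow> nat \<Rightarrow> real" where
  "queue_transition M S Y q k = measure M {\<omega> \<in> space M. (q - S 0 \<omega>) + Y 0 \<omega> = k}"

definition stationary_law ::
    "'a measure \<Rightarrow> (nat \<Rightarrow> 'a \<Rightarrow> nat) \<Rightarrow> (nat \<Rightarrow> 'a \<Rightarrow> nat) \<Rightarrow> nat pmf \<Rightarrow> bool" where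
  "stationary_law M S Y \<pi> \<longleftrightarrow>
     (\<forall>k. pmf \<pi> k = measure_pmf.expectation \<pi> (\<lambda>q. queue_transition M S Y q k))"

(* Existence of the (proper) steady state distribution. Uniqueness is automatic except when S and Y
   both vanish almost surely: then the queue never changes and every law is stationary. *)
definition stable :: "'a measure \<Rightarrow> (nat \<Rightarrow> 'a \<Rightarrow> nat) \<Rightarrow> (nat \<Rightarrow> 'a \<Rightarrow> nat) \<Rightarrow> bool" where
  "stable M S Y \<longleftrightarrow> (\<exists>!\<pi>. stationary_law M S Y \<pi>)"

definition pgf :: "'a measure \<Rightarrow> ('a \<Rightarrow> nat) \<Rightarrow> complex \<Rightarrow> complex" where
  "pgf M X z = (\<Sum>k. of_real (measure M {\<omega> \<in> space M. X \<omega> = k}) * z ^ k)"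

definition char_fun :: "nat \<Rightarrow> nat pmf \<Rightarrow> (complex \<Rightarrow> complex) \<Rightarrow> complex \<Rightarrow> complex" where
  "char_fun C s G z = z ^ C - G z * (\<Sum>u\<le>C. of_real (pmf s u) * z ^ (C - u))"

(* z 0, ..., z (m - 1) are the roots of f in the closed unit disk, listed by multiplicity. *)
definition lists_disk_roots ::
    "(complex \<Rightarrow> complex) \<Rightarrow> nat \<Rightarrow> (nat \<Rightarrow> complex) \<Rightarrow> bool" where
  "lists_disk_roots f m z \<longleftrightarrow>
     (\<forall>i<m. norm (z i) \<le> 1 \<and> f (z i) = 0) \<and>
     (\<forall>w. norm w \<le> 1 \<and> f w = 0 \<longrightarrow> int (card {i. i < m \<and> z i = w}) = zorder f w)"

end

theory Submission
  imports Defs "HOL-Computational_Algebra.Fundamental_Theorem_Algebra"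
begin

text \<open>
  Let \<open>P\<close> be the generating function of the steady state queue. Stationarity gives
  \<open>F z * P z = Y z * G z\<close> on the closed unit disk, where \<open>G\<close> is a polynomial of degree at most
  \<open>C\<close> with \<open>G 1 = 0\<close>. Comparing one-sided derivatives at \<open>1\<close> yields
  \<open>E S - E Y = G' 1 = E (max 0 (S - Q)) \<ge> 0\<close>, and equality would force \<open>S = Y = 0\<close> almost surely,
  where uniqueness of the stationary law fails. Every root of \<open>F\<close> in the open disk is a root of
  \<open>G\<close> with at least the same multiplicity, and the roots on the unit circle are simple because
  \<open>w * F' w = w ^ C * (E S - E Y)\<close> there. As \<open>C\<close> roots are listed, \<open>G\<close> is a constant times the
  product of the \<open>z - z i\<close>.

  The headway has an exponential moment, so \<open>Y\<close> and hence \<open>F\<close> are holomorphic beyond the unit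
  circle, and \<open>Y * G / F\<close> continues \<open>P\<close> holomorphically across \<open>1\<close>. Since the coefficients of
  \<open>P\<close> are nonnegative, monotone convergence along \<open>x \<rightarrow> 1\<close> identifies the derivatives of the
  continuation at \<open>1\<close> with the factorial moments of the queue.
\<close>

section \<open>Exponential moments of headways and arrivals\<close>

text \<open>Neither moments of the queue nor a positive drift are given: stability enters only as
  unique existence of the stationary law. A priori \<open>P\<close> is merely continuous on the
  closed disk, \<open>P'\<close> might blow up at 1, and finiteness of the first two moments has to
  come out as a conclusion. Hence \<open>P\<close> is never differentiated at 1 before a
  continuation is available.

  The constant in the factorization of \<open>G\<close> is not computed from the unknown boundary
  probabilities of the queue; the normalization \<open>P 1 = 1\<close> fixes it. With F(z) = (z - 1)
  F1(z), the identity P F1 = Y c prod (z - z_i) has no singular factor left at 1 and is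
  differentiated there once and twice. As F1''(1) = F'''(1) / 3, the variance involves third central
  moments of S and Y.

  The shape of the formulas reflects that, for P(1) = 1, the mean is (log P)' and the variance is
  (log P)' + (log P)'' at 1. Each factor of the identity contributes additively, so the sums over
  roots stand apart from the rational part.\<close>

lemma poisson_prob_nonneg: "0 \<le> r \<Longrightarrow> 0 \<le> poisson_prob r k"
  by (simp add: poisson_prob_def)

lemma poisson_prob_exp_sums:
  "(\<lambda>k. poisson_prob r k * c ^ k) sums exp (r * (c - 1))"
proof -
  have "(\<lambda>k. exp (- r) * ((r * c) ^ k /\<^sub>R fact k)) sums (exp (- r) * exp (r * c))"
    by (intro sums_mult exp_converges)
  then show ?thesis
    by (simp add: poisson_prob_def power_mult_distrib field_simps flip: exp_add)
qed

lemma prob_space_poisson_law: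
  assumes "0 \<le> r"
  shows "prob_space (poisson_law r)"
proof
  have "emeasure (poisson_law r) (space (poisson_law r)) = (\<Sum>k. ennreal (poisson_prob r k))"
    by (simp add: poisson_law_def emeasure_density nn_integral_count_space_nat)
  also have "\<dots> = ennreal 1"
    using poisson_prob_exp_sums[of r 1] assms
    by (simp add: suminf_ennreal2 poisson_prob_nonneg sums_iff)
  finally show "emeasure (poisson_law r) (space (poisson_law r)) = 1" by simp
qed

lemma prob_space_exponential_law: "0 < \<theta> \<Longrightarrow> prob_space (exponential_law \<theta>)"
  unfolding exponential_law_def by (rule prob_space_exponential_density)

lemma sets_exponential_law [measurable_cong]: "sets (exponential_law \<theta>) = sets borel"
  by (simp add: exponential_law_def)

lemma sets_poisson_law [measurable_cong]: "sets (poisson_law r) = sets (count_space UNIV)"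
  by (simp add: poisson_law_def)

text \<open>Exponential tilting: the weighted density is a constant times the exponential density of
  the smaller rate \<open>\<theta> - \<epsilon>\<close>, which integrates to 1.\<close>

lemma exponential_law_exp_moment:
  assumes "0 \<le> \<epsilon>" "\<epsilon> < \<theta>"
  shows "(\<integral>\<^sup>+x. ennreal (exp (\<epsilon> * x)) \<partial>exponential_law \<theta>) = ennreal (\<theta> / (\<theta> - \<epsilon>))"
proof -
  interpret E: prob_space "density lborel (\<lambda>x. ennreal (exponential_density (\<theta> - \<epsilon>) x))"
    using assms by (intro prob_space_exponential_density) auto
  have tot: "(\<integral>\<^sup>+x. ennreal (exponential_density (\<theta> - \<epsilon>) x) \<partial>lborel) = 1"
    using E.emeasure_space_1 by (simp add: emeasure_density)
  have "(\<integral>\<^sup>+x. ennreal (exp (\<epsilon> * x)) \<partial>exponential_law \<theta>) =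
      (\<integral>\<^sup>+x. ennreal (exponential_density \<theta> x) * ennreal (exp (\<epsilon> * x)) \<partial>lborel)"
    unfolding exponential_law_def by (intro nn_integral_density) auto
  also have "\<dots> = (\<integral>\<^sup>+x. ennreal (\<theta> / (\<theta> - \<epsilon>)) * ennreal (exponential_density (\<theta> - \<epsilon>) x) \<partial>lborel)"
    using assms
    by (intro nn_integral_cong)
       (auto simp: exponential_density_def exp_diff exp_minus field_simps simp flip: ennreal_mult)
  also have "\<dots> = ennreal (\<theta> / (\<theta> - \<epsilon>))"
    by (subst nn_integral_cmult) (auto simp: tot)
  finally show ?thesis .
qed

text \<open>The number of summands is itself a coordinate; as it ranges over a countable set,
  measurability for each fixed number suffices.\<close>

lemma measurable_compound_sum [measurable]:
  "(\<lambda>(k, x). \<Sum>i<k. x i) \<in>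
     borel_measurable (poisson_law r \<Otimes>\<^sub>M (\<Pi>\<^sub>M i\<in>(UNIV :: nat set). exponential_law \<theta>))"
proof -
  have "(\<lambda>w. (\<lambda>k w. \<Sum>i<k. snd w i) (fst w) w) \<in>
     borel_measurable (poisson_law r \<Otimes>\<^sub>M (\<Pi>\<^sub>M i\<in>(UNIV :: nat set). exponential_law \<theta>))"
    by (rule measurable_compose_countable) measurable
  then show ?thesis by (simp add: case_prod_beta')
qed

lemma prob_space_compound_law:
  assumes "0 \<le> r" "0 < \<theta>"
  shows "prob_space (compound_law r \<theta>)"
proof -
  interpret P: prob_space "poisson_law r" by (rule prob_space_poisson_law) fact
  interpret E: product_prob_space "\<lambda>_::nat. exponential_law \<theta>" UNIV
    using prob_space_exponential_law[OF assms(2)]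
    by (simp add: product_prob_space_def product_prob_space_axioms_def product_sigma_finite_def
        prob_space_imp_sigma_finite)
  interpret PE: pair_prob_space "poisson_law r" "\<Pi>\<^sub>M i\<in>(UNIV :: nat set). exponential_law \<theta>" ..
  show ?thesis
    unfolding compound_law_def by (intro PE.prob_space_distr measurable_compound_sum)
qed

lemma sets_compound_law [measurable_cong]: "sets (compound_law r \<theta>) = sets borel"
  by (simp add: compound_law_def)

text \<open>Given \<open>k\<close> summands, independence yields \<open>c ^ k\<close> with
  \<open>c\<close> the exponential moment of one summand; averaging over the Poisson count evaluates
  its generating function at \<open>c\<close>.\<close>

lemma compound_law_exp_moment:
  assumes "0 \<le> r" "0 \<le> \<epsilon>" "\<epsilon> < \<theta>"
  shows "(\<integral>\<^sup>+x. ennreal (exp (\<epsilon> * x)) \<partial>compound_law r \<theta>) < \<infinity>"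
proof -
  let ?E = "\<Pi>\<^sub>M i\<in>(UNIV :: nat set). exponential_law \<theta>"
  define c where "c = \<theta> / (\<theta> - \<epsilon>)"
  have c: "0 \<le> c" using assms by (simp add: c_def)
  interpret P: prob_space "poisson_law r" by (rule prob_space_poisson_law) fact
  interpret E: product_prob_space "\<lambda>_::nat. exponential_law \<theta>" UNIV
    using prob_space_exponential_law[of \<theta>] assms
    by (simp add: product_prob_space_def product_prob_space_axioms_def product_sigma_finite_def
        prob_space_imp_sigma_finite)
  interpret PE: pair_prob_space "poisson_law r" ?E ..
  \<comment> \<open>Only the first \<open>k\<close> coordinates matter, so the infinite product
    measure is projected to a finite one, where the integral of a product factorizes.\<close>
  have inner: "(\<integral>\<^sup>+x. ennreal (exp (\<epsilon> * (\<Sum>i<k. x i))) \<partial>?E) = ennreal (c ^ k)" for k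
  proof -
    have "(\<integral>\<^sup>+x. ennreal (exp (\<epsilon> * (\<Sum>i<k. x i))) \<partial>?E) =
        (\<integral>\<^sup>+x. (\<Prod>i\<in>{..<k}. ennreal (exp (\<epsilon> * restrict x {..<k} i))) \<partial>?E)"
      by (intro nn_integral_cong) (simp add: prod_ennreal sum_distrib_left exp_sum)
    also have "\<dots> = (\<integral>\<^sup>+x. (\<Prod>i\<in>{..<k}. ennreal (exp (\<epsilon> * x i)))
        \<partial>distr ?E (\<Pi>\<^sub>M i\<in>{..<k}. exponential_law \<theta>) (\<lambda>x. restrict x {..<k}))"
      by (subst nn_integral_distr) auto
    also have "\<dots> = (\<integral>\<^sup>+x. (\<Prod>i\<in>{..<k}. ennreal (exp (\<epsilon> * x i))) \<partial>(\<Pi>\<^sub>M i\<in>{..<k}. exponential_law \<theta>))"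
      by (subst E.distr_PiM_restrict_finite) auto
    also have "\<dots> = (\<Prod>i\<in>{..<k}. \<integral>\<^sup>+x. ennreal (exp (\<epsilon> * x)) \<partial>exponential_law \<theta>)"
      by (intro E.product_nn_integral_prod) auto
    also have "\<dots> = ennreal (c ^ k)"
      using c assms by (simp add: exponential_law_exp_moment c_def ennreal_power)
    finally show ?thesis .
  qed
  have "(\<integral>\<^sup>+x. ennreal (exp (\<epsilon> * x)) \<partial>compound_law r \<theta>) =
      (\<integral>\<^sup>+w. ennreal (exp (\<epsilon> * (case w of (k, x) \<Rightarrow> \<Sum>i<k. x i))) \<partial>(poisson_law r \<Otimes>\<^sub>M ?E))"
    unfolding compound_law_def by (subst nn_integral_distr) auto
  also have "\<dots> = (\<integral>\<^sup>+k. \<integral>\<^sup>+x. ennreal (exp (\<epsilon> * (\<Sum>i<k. x i))) \<partial>?E \<partial>poisson_law r)"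
    by (subst E.P.nn_integral_fst[symmetric]) auto
  also have "\<dots> = (\<integral>\<^sup>+k. ennreal (c ^ k) \<partial>poisson_law r)"
    by (simp add: inner)
  also have "\<dots> = (\<Sum>k. ennreal (poisson_prob r k * c ^ k))"
    using assms(1) c
    by (simp add: poisson_law_def nn_integral_density nn_integral_count_space_nat
        poisson_prob_nonneg ennreal_mult)
  also have "\<dots> = ennreal (exp (r * (c - 1)))"
    using poisson_prob_exp_sums[of r c] assms(1) c
    by (subst suminf_ennreal2) (auto simp: sums_iff poisson_prob_nonneg)
  finally show ?thesis by simp
qed

lemma exp_le_exp_max: "exp (\<epsilon> * max 0 x) \<le> 1 + exp (\<epsilon> * x)" for x :: real
  by (cases "0 \<le> x") (auto simp: max_def)

text \<open>Truncation at 0 raises the exponential by at most 1, which a probability measure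
  integrates to a finite amount.\<close>

lemma nonneg_part_exp_moment:
  assumes L: "prob_space L" "sets L = sets borel"
    and fin: "(\<integral>\<^sup>+x. ennreal (exp (\<epsilon> * x)) \<partial>L) < \<infinity>"
  shows "(\<integral>\<^sup>+x. ennreal (exp (\<epsilon> * x)) \<partial>distr L borel (\<lambda>h. max 0 h)) < \<infinity>"
proof -
  interpret prob_space L by fact
  note [measurable_cong] = L(2)
  have "(\<integral>\<^sup>+x. ennreal (exp (\<epsilon> * x)) \<partial>distr L borel (\<lambda>h. max 0 h)) =
      (\<integral>\<^sup>+x. ennreal (exp (\<epsilon> * max 0 x)) \<partial>L)"
    by (subst nn_integral_distr) auto
  also have "\<dots> \<le> (\<integral>\<^sup>+x. 1 + ennreal (exp (\<epsilon> * x)) \<partial>L)"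
    by (intro nn_integral_mono)
       (auto simp: exp_le_exp_max simp flip: ennreal_plus ennreal_1 intro!: ennreal_leI)
  also have "\<dots> = 1 + (\<integral>\<^sup>+x. ennreal (exp (\<epsilon> * x)) \<partial>L)"
    by (subst nn_integral_add) (auto simp: emeasure_space_1)
  also have "\<dots> < \<infinity>" using fin by simp
  finally show ?thesis .
qed

section \<open>Exponential moments of the headway laws\<close>

lemma prob_space_raw_headway_law:
  assumes "0 \<le> \<gamma>" "0 < \<theta>" "0 < Tn"
  shows "prob_space (raw_headway_law Hbar Fbar \<theta> \<gamma> Tn TN)"
proof -
  interpret A: prob_space "compound_law (\<gamma> * Tn) \<theta>"
    using assms by (intro prob_space_compound_law) auto
  interpret AA: pair_prob_space "compound_law (\<gamma> * Tn) \<theta>" "compound_law (\<gamma> * Tn) \<theta>" ..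
  show ?thesis unfolding raw_headway_law_def by (intro AA.prob_space_distr) simp
qed

lemma AE_compound_law_nonneg:
  assumes "0 \<le> r" "0 < \<theta>"
  shows "AE x in compound_law r \<theta>. 0 \<le> x"
proof -
  let ?E = "\<Pi>\<^sub>M i\<in>(UNIV :: nat set). exponential_law \<theta>"
  interpret P: prob_space "poisson_law r" by (rule prob_space_poisson_law) fact
  interpret E: product_prob_space "\<lambda>_::nat. exponential_law \<theta>" UNIV
    using prob_space_exponential_law[OF assms(2)]
    by (simp add: product_prob_space_def product_prob_space_axioms_def product_sigma_finite_def
        prob_space_imp_sigma_finite)
  interpret PE: pair_prob_space "poisson_law r" ?E ..
  have "AE y in exponential_law \<theta>. 0 \<le> y"
    unfolding exponential_law_def by (subst AE_density) (auto simp: exponential_density_def)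
  then have "AE x in ?E. 0 \<le> x i" for i
    by (intro AE_PiM_component) (auto intro: prob_space_exponential_law assms)
  then have nn: "AE x in ?E. \<forall>i. 0 \<le> x i"
    by (simp add: AE_all_countable)
  have "AE w in poisson_law r \<Otimes>\<^sub>M ?E. 0 \<le> (case w of (k, x) \<Rightarrow> \<Sum>i<k. x i)"
  proof (rule PE.AE_pair_measure)
    show "{w \<in> space (poisson_law r \<Otimes>\<^sub>M ?E). 0 \<le> (case w of (k, x) \<Rightarrow> \<Sum>i<k. x i)}
        \<in> sets (poisson_law r \<Otimes>\<^sub>M ?E)"
      by measurable
    have "AE x in ?E. 0 \<le> (\<Sum>i<k. x i)" for k
      using nn by eventually_elim (auto intro: sum_nonneg)
    then show "AE k in poisson_law r. AE x in ?E. 0 \<le> (case (k, x) of (k, x) \<Rightarrow> \<Sum>i<k. x i)"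
      by simp
  qed
  then show ?thesis
    unfolding compound_law_def by (subst AE_distr_iff) auto
qed

text \<open>The subtracted compound sum is almost surely nonnegative, so dropping it only increases
  the integrand; what remains is a constant times the exponential moment of the other sum.\<close>

lemma raw_headway_law_exp_moment:
  assumes "0 \<le> \<gamma>" "0 < Tn" "0 \<le> \<epsilon>" "\<epsilon> < \<theta>"
  shows "(\<integral>\<^sup>+x. ennreal (exp (\<epsilon> * x)) \<partial>raw_headway_law Hbar Fbar \<theta> \<gamma> Tn TN) < \<infinity>"
proof -
  let ?K = "compound_law (\<gamma> * Tn) \<theta>"
  define c where "c = Hbar + 2 * \<gamma> * TN / (\<theta> * Fbar)"
  have \<theta>: "0 < \<theta>" using assms by linarith
  interpret A: prob_space ?K
    using assms by (intro prob_space_compound_law) auto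
  interpret AA: pair_prob_space ?K ?K ..
  have bound: "(\<integral>\<^sup>+b. ennreal (exp (\<epsilon> * (c + a - b))) \<partial>?K) \<le> ennreal (exp (\<epsilon> * c)) * ennreal (exp (\<epsilon> * a))" for a
  proof -
    have "AE b in ?K. 0 \<le> b"
      using assms \<theta> by (intro AE_compound_law_nonneg) auto
    then have "AE b in ?K. ennreal (exp (\<epsilon> * (c + a - b))) \<le> ennreal (exp (\<epsilon> * c)) * ennreal (exp (\<epsilon> * a))"
    proof eventually_elim
      case (elim b)
      have "exp (\<epsilon> * (c + a - b)) \<le> exp (\<epsilon> * c) * exp (\<epsilon> * a)"
        using mult_left_mono[OF elim assms(3)] by (simp add: algebra_simps flip: exp_add)
      then show ?case by (simp add: ennreal_leI flip: ennreal_mult)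
    qed
    then have "(\<integral>\<^sup>+b. ennreal (exp (\<epsilon> * (c + a - b))) \<partial>?K) \<le>
        (\<integral>\<^sup>+b. ennreal (exp (\<epsilon> * c)) * ennreal (exp (\<epsilon> * a)) \<partial>?K)"
      by (rule nn_integral_mono_AE)
    then show ?thesis by (simp add: A.emeasure_space_1)
  qed
  have "(\<integral>\<^sup>+x. ennreal (exp (\<epsilon> * x)) \<partial>raw_headway_law Hbar Fbar \<theta> \<gamma> Tn TN) =
      (\<integral>\<^sup>+a. \<integral>\<^sup>+b. ennreal (exp (\<epsilon> * (c + a - b))) \<partial>?K \<partial>?K)"
    unfolding raw_headway_law_def c_def[symmetric]
    by (subst nn_integral_distr) (auto simp: A.nn_integral_fst[symmetric])
  also have "\<dots> \<le> (\<integral>\<^sup>+a. ennreal (exp (\<epsilon> * c)) * ennreal (exp (\<epsilon> * a)) \<partial>?K)"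
    by (intro nn_integral_mono bound)
  also have "\<dots> = ennreal (exp (\<epsilon> * c)) * (\<integral>\<^sup>+a. ennreal (exp (\<epsilon> * a)) \<partial>?K)"
    by (intro nn_integral_cmult) auto
  also have "\<dots> < \<infinity>"
    using compound_law_exp_moment[of "\<gamma> * Tn" \<epsilon> \<theta>] assms by (simp add: ennreal_mult_less_top)
  finally show ?thesis .
qed

text \<open>Completing the square turns the weighted density into a constant times the normal
  density with mean shifted to \<open>m + \<epsilon> * \<sigma>\<^sup>2\<close>. The degenerate case
  is a point mass.\<close>

lemma normal_law_exp_moment:
  assumes "0 \<le> v"
  shows "(\<integral>\<^sup>+x. ennreal (exp (\<epsilon> * x)) \<partial>normal_law m v) < \<infinity>"
proof (cases "v = 0")
  case False
  define \<sigma> where "\<sigma> = sqrt v"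
  have \<sigma>: "0 < \<sigma>" "v = \<sigma>\<^sup>2" using assms False by (auto simp: \<sigma>_def)
  interpret N: prob_space "density lborel (\<lambda>x. ennreal (normal_density (m + \<epsilon> * \<sigma>\<^sup>2) \<sigma> x))"
    by (intro prob_space_normal_density \<sigma>)
  have tot: "(\<integral>\<^sup>+x. ennreal (normal_density (m + \<epsilon> * \<sigma>\<^sup>2) \<sigma> x) \<partial>lborel) = 1"
    using N.emeasure_space_1 by (simp add: emeasure_density)
  have complete_square: "- (x - m)\<^sup>2 / (2 * \<sigma>\<^sup>2) + \<epsilon> * x =
      (\<epsilon> * m + \<epsilon>\<^sup>2 * \<sigma>\<^sup>2 / 2) + - (x - (m + \<epsilon> * \<sigma>\<^sup>2))\<^sup>2 / (2 * \<sigma>\<^sup>2)" for x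
    using \<sigma> by (simp add: field_simps power2_eq_square)
  have "(\<integral>\<^sup>+x. ennreal (exp (\<epsilon> * x)) \<partial>normal_law m v) =
      (\<integral>\<^sup>+x. ennreal (normal_density m \<sigma> x) * ennreal (exp (\<epsilon> * x)) \<partial>lborel)"
    using False by (simp add: normal_law_def \<sigma>_def[symmetric] nn_integral_density)
  also have "\<dots> = (\<integral>\<^sup>+x. ennreal (exp (\<epsilon> * m + \<epsilon>\<^sup>2 * \<sigma>\<^sup>2 / 2)) *
      ennreal (normal_density (m + \<epsilon> * \<sigma>\<^sup>2) \<sigma> x) \<partial>lborel)"
  proof (intro nn_integral_cong)
    fix x
    have "exp (- (x - m)\<^sup>2 / (2 * \<sigma>\<^sup>2)) * exp (\<epsilon> * x) = exp (\<epsilon> * m + \<epsilon>\<^sup>2 * \<sigma>\<^sup>2 / 2) *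
        exp (- (x - (m + \<epsilon> * \<sigma>\<^sup>2))\<^sup>2 / (2 * \<sigma>\<^sup>2))"
      unfolding exp_add[symmetric] complete_square ..
    then show "ennreal (normal_density m \<sigma> x) * ennreal (exp (\<epsilon> * x)) =
        ennreal (exp (\<epsilon> * m + \<epsilon>\<^sup>2 * \<sigma>\<^sup>2 / 2)) * ennreal (normal_density (m + \<epsilon> * \<sigma>\<^sup>2) \<sigma> x)"
      by (simp add: normal_density_def flip: ennreal_mult)
  qed
  also have "\<dots> < \<infinity>"
    by (subst nn_integral_cmult) (auto simp: tot)
  finally show ?thesis .
qed (simp add: normal_law_def nn_integral_return)

lemma prob_space_normal_law: "0 \<le> v \<Longrightarrow> prob_space (normal_law m v)"
  by (auto simp: normal_law_def intro!: prob_space_return prob_space_normal_density)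

lemma sets_normal_law: "sets (normal_law m v) = sets borel"
  by (simp add: normal_law_def)

lemma central_moment_2_nonneg: "0 \<le> central_moment M 2 X"
  unfolding central_moment_def by (intro integral_nonneg_AE) simp

lemma headway_exp_moment:
  assumes "0 < \<theta>" "0 \<le> \<gamma>" "0 < Tn"
    and "hw = headway_law Hbar Fbar \<theta> \<gamma> Tn TN \<or> hw = normal_headway_law Hbar Fbar \<theta> \<gamma> Tn TN"
  obtains \<epsilon> where "0 < \<epsilon>" "(\<integral>\<^sup>+x. ennreal (exp (\<epsilon> * x)) \<partial>hw) < \<infinity>"
proof
  \<comment> \<open>The compound sums allow any exponent below \<open>\<theta>\<close>, the normal
    law allows every exponent; half of \<open>\<theta>\<close> serves both.\<close>
  show "0 < \<theta> / 2" using assms by simp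
  let ?L = "raw_headway_law Hbar Fbar \<theta> \<gamma> Tn TN"
  show "(\<integral>\<^sup>+x. ennreal (exp (\<theta> / 2 * x)) \<partial>hw) < \<infinity>"
    using assms(4)
  proof
    assume hw: "hw = headway_law Hbar Fbar \<theta> \<gamma> Tn TN"
    show ?thesis unfolding hw headway_law_def
      using assms
      by (intro nonneg_part_exp_moment prob_space_raw_headway_law raw_headway_law_exp_moment)
         (auto simp: raw_headway_law_def)
  next
    assume hw: "hw = normal_headway_law Hbar Fbar \<theta> \<gamma> Tn TN"
    show ?thesis unfolding hw normal_headway_law_def Let_def
      by (intro nonneg_part_exp_moment prob_space_normal_law normal_law_exp_moment
          central_moment_2_nonneg sets_normal_law)
  qed
qed

lemma headway_nonneg:
  assumes "hw = headway_law Hbar Fbar \<theta> \<gamma> Tn TN \<or> hw = normal_headway_law Hbar Fbar \<theta> \<gamma> Tn TN"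
  shows "AE h in hw. 0 \<le> h" "sets hw = sets borel"
proof -
  obtain L where L: "hw = distr L borel (\<lambda>h. max 0 h)" "sets L = sets borel"
    using assms
    by (auto simp: headway_law_def normal_headway_law_def Let_def raw_headway_law_def sets_normal_law)
  note [measurable_cong] = L(2)
  show "AE h in hw. 0 \<le> h" unfolding L(1) by (subst AE_distr_iff) auto
  show "sets hw = sets borel" by (simp add: L(1))
qed

section \<open>Arrivals during one headway\<close>

context station_queue
begin

lemma prob_space_hw: "prob_space hw"
  using H_law[of 0] H_measurable[of 0] by (metis prob_space_distr)

lemma prob_Y0:
  assumes "sets hw = sets borel"
  shows "prob {\<omega> \<in> space M. Y 0 \<omega> = k} = (\<integral>h. poisson_prob (lam * h) k \<partial>hw)"
  using Y_law[of UNIV 0 k] by simp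

text \<open>\<open>Y 0\<close> is mixed Poisson, so E r^Y = E exp (lam H (r - 1)), which is finite
  once lam (r - 1) is at most the exponent available for the headway.\<close>

lemma Y_exp_moment:
  assumes hw: "sets hw = sets borel" "AE h in hw. 0 \<le> h"
    and \<epsilon>: "0 < \<epsilon>" "(\<integral>\<^sup>+x. ennreal (exp (\<epsilon> * x)) \<partial>hw) < \<infinity>"
  obtains r where "1 < r" "summable (\<lambda>k. prob {\<omega> \<in> space M. Y 0 \<omega> = k} * r ^ k)"
proof
  interpret W: prob_space hw by (rule prob_space_hw)
  \<comment> \<open>Dividing by \<open>lam + 1\<close> instead of \<open>lam\<close> covers rate 0
    and still gives \<open>lam * (r - 1) \<le> \<epsilon>\<close>.\<close>
  define r where "r = 1 + \<epsilon> / (lam + 1)"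
  show r: "1 < r" using \<epsilon>(1) rate by (simp add: r_def)
  note [measurable_cong] = hw(1)
  have [measurable]: "(\<lambda>h. poisson_prob (lam * h) k) \<in> borel_measurable hw" for k
    unfolding poisson_prob_def by measurable
  have le1: "poisson_prob (lam * h) k \<le> 1" if "0 \<le> h" for h k
    using poisson_prob_exp_sums[of "lam * h" 1] that rate
      sum_le_suminf[of "\<lambda>k. poisson_prob (lam * h) k" "{k}"]
    by (auto simp: sums_iff poisson_prob_nonneg)
  have ennreal_prob: "ennreal (prob {\<omega> \<in> space M. Y 0 \<omega> = k}) = (\<integral>\<^sup>+h. ennreal (poisson_prob (lam * h) k) \<partial>hw)" for k
    unfolding prob_Y0[OF hw(1)]
  proof (rule nn_integral_eq_integral[symmetric])
    show "AE h in hw. 0 \<le> poisson_prob (lam * h) k"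
      using hw(2) by eventually_elim (use rate in \<open>simp add: poisson_prob_nonneg\<close>)
    show "integrable hw (\<lambda>h. poisson_prob (lam * h) k)"
    proof (rule W.integrable_const_bound[where B = 1])
      show "AE h in hw. norm (poisson_prob (lam * h) k) \<le> 1"
        using hw(2) by eventually_elim (use rate in \<open>simp add: poisson_prob_nonneg le1\<close>)
    qed simp
  qed
  have "(\<Sum>k. ennreal (prob {\<omega> \<in> space M. Y 0 \<omega> = k} * r ^ k)) =
      (\<Sum>k. \<integral>\<^sup>+h. ennreal (poisson_prob (lam * h) k) * ennreal (r ^ k) \<partial>hw)"
    using r by (simp add: ennreal_mult ennreal_prob nn_integral_multc)
  also have "\<dots> = (\<integral>\<^sup>+h. (\<Sum>k. ennreal (poisson_prob (lam * h) k) * ennreal (r ^ k)) \<partial>hw)"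
    by (intro nn_integral_suminf[symmetric]) auto
  also have "\<dots> \<le> (\<integral>\<^sup>+h. ennreal (exp (\<epsilon> * h)) \<partial>hw)"
  proof (rule nn_integral_mono_AE)
    show "AE h in hw. (\<Sum>k. ennreal (poisson_prob (lam * h) k) * ennreal (r ^ k)) \<le> ennreal (exp (\<epsilon> * h))"
      using hw(2)
    proof eventually_elim
      case (elim h)
      have "(\<Sum>k. ennreal (poisson_prob (lam * h) k) * ennreal (r ^ k)) =
          (\<Sum>k. ennreal (poisson_prob (lam * h) k * r ^ k))"
        using r rate elim by (simp add: ennreal_mult poisson_prob_nonneg)
      also have "\<dots> = ennreal (exp (lam * h * (r - 1)))"
        using poisson_prob_exp_sums[of "lam * h" r] r rate elim
        by (subst suminf_ennreal2) (auto simp: sums_iff poisson_prob_nonneg)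
      also have "\<dots> \<le> ennreal (exp (\<epsilon> * h))"
      proof -
        have "lam * (\<epsilon> / (lam + 1)) \<le> \<epsilon>"
          using rate \<epsilon>(1) by (simp add: field_simps)
        then have "lam * (\<epsilon> / (lam + 1)) * h \<le> \<epsilon> * h"
          using elim by (rule mult_right_mono)
        then show ?thesis by (intro ennreal_leI) (simp add: r_def ac_simps)
      qed
      finally show ?case .
    qed
  qed
  also have "\<dots> < \<infinity>" by fact
  finally show "summable (\<lambda>k. prob {\<omega> \<in> space M. Y 0 \<omega> = k} * r ^ k)"
    using r by (intro summable_suminf_not_top) auto
qed

text \<open>A strictly positive integrand has nonzero integral. Positivity of Y(0) matters twice
  later: it excludes that \<open>F\<close> vanishes identically in the nondegenerate case, and it
  lets a root of \<open>F\<close> at 0 pass to \<open>G\<close>.\<close>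

lemma prob_no_arrivals_pos:
  assumes hw: "sets hw = sets borel" "AE h in hw. 0 \<le> h"
  shows "0 < prob {\<omega> \<in> space M. Y 0 \<omega> = 0}"
proof -
  interpret W: prob_space hw by (rule prob_space_hw)
  note [measurable_cong] = hw(1)
  have eq: "prob {\<omega> \<in> space M. Y 0 \<omega> = 0} = (\<integral>h. exp (- (lam * h)) \<partial>hw)"
    unfolding prob_Y0[OF hw(1)] by (simp add: poisson_prob_def)
  have int: "integrable hw (\<lambda>h. exp (- (lam * h)))"
  proof (rule W.integrable_const_bound[where B = 1])
    show "AE h in hw. norm (exp (- (lam * h))) \<le> 1"
      using hw(2) by eventually_elim (use rate in simp)
  qed simp
  have "(\<integral>h. exp (- (lam * h)) \<partial>hw) \<noteq> 0"
    by (subst integral_nonneg_eq_0_iff_AE[OF int]) (auto simp: W.AE_False)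
  moreover have "0 \<le> (\<integral>h. exp (- (lam * h)) \<partial>hw)" by simp
  ultimately show ?thesis unfolding eq by linarith
qed

end

section \<open>Generating functions of distributions on the naturals\<close>

lemma pmf_nat_expectation:
  fixes f :: "nat \<Rightarrow> 'b::{banach, second_countable_topology}"
  assumes "summable (\<lambda>k. pmf p k * norm (f k))"
  shows "integrable (measure_pmf p) f"
    and "(\<lambda>k. pmf p k *\<^sub>R f k) sums measure_pmf.expectation p f"
proof -
  have int: "integrable (count_space UNIV) (\<lambda>k. pmf p k *\<^sub>R f k)"
    using assms by (simp add: integrable_count_space_nat_iff)
  then show "integrable (measure_pmf p) f"
    unfolding measure_pmf_eq_density by (subst integrable_density) auto
  have "measure_pmf.expectation p f = (\<integral>k. pmf p k *\<^sub>R f k \<partial>count_space UNIV)"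
    unfolding measure_pmf_eq_density by (subst integral_density) auto
  with sums_integral_count_space_nat[OF int]
  show "(\<lambda>k. pmf p k *\<^sub>R f k) sums measure_pmf.expectation p f" by simp
qed

lemma summable_pmf_nat: "summable (pmf (p :: nat pmf))"
proof -
  have "integrable (count_space UNIV) (pmf p)" by (rule integrable_pmf)
  then show ?thesis by (simp add: integrable_count_space_nat_iff)
qed

lemma pmf_nat_sums_1: "pmf (p :: nat pmf) sums 1"
proof -
  have "summable (\<lambda>k. pmf p k * norm (1::real))" using summable_pmf_nat[of p] by simp
  from pmf_nat_expectation(2)[OF this] show ?thesis by simp
qed

definition pmf_gf :: "nat pmf \<Rightarrow> complex \<Rightarrow> complex" where
  "pmf_gf p z = (\<Sum>k. of_real (pmf p k) * z ^ k)"

lemma summable_pmf_gf: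
  fixes z :: complex
  assumes "summable (\<lambda>k. pmf p k * r ^ k)" "norm z \<le> r"
  shows "summable (\<lambda>k. pmf p k * norm (z ^ k))"
proof (rule summable_comparison_test[OF _ assms(1)], intro exI allI impI)
  fix k
  have "norm z ^ k \<le> r ^ k" using assms(2) by (intro power_mono) auto
  then show "norm (pmf p k * norm (z ^ k)) \<le> pmf p k * r ^ k"
    using mult_left_mono[OF _ pmf_nonneg[of p k]] by (auto simp: norm_power)
qed

lemma pmf_gf_sums:
  fixes z :: complex
  assumes "summable (\<lambda>k. pmf p k * norm (z ^ k))"
  shows "(\<lambda>k. of_real (pmf p k) * z ^ k) sums pmf_gf p z"
    and "pmf_gf p z = measure_pmf.expectation p (\<lambda>k. z ^ k)"
  using pmf_nat_expectation(2)[OF assms] by (simp_all add: pmf_gf_def scaleR_conv_of_real sums_iff)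

lemma summable_pmf_disk: "norm z \<le> 1 \<Longrightarrow> summable (\<lambda>k. pmf p k * norm (z ^ k))"
  for z :: complex
  using summable_pmf_gf[of p 1 z] summable_pmf_nat by simp

lemma pmf_gf_eq_expectation:
  "norm z \<le> 1 \<Longrightarrow> pmf_gf p z = measure_pmf.expectation p (\<lambda>k. z ^ k)"
  by (intro pmf_gf_sums summable_pmf_disk)

lemma pmf_gf_1 [simp]: "pmf_gf p 1 = 1"
  by (simp add: pmf_gf_eq_expectation)

lemma pmf_gf_0: "pmf_gf p 0 = of_real (pmf p 0)"
  by (simp add: pmf_gf_def)

lemma norm_pmf_gf_le_1:
  assumes "norm z \<le> 1"
  shows "norm (pmf_gf p z) \<le> 1"
proof -
  have "norm (pmf_gf p z) \<le> measure_pmf.expectation p (\<lambda>k. norm (z ^ k))"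
    unfolding pmf_gf_eq_expectation[OF assms] by (rule integral_norm_bound)
  also have "\<dots> \<le> measure_pmf.expectation p (\<lambda>k. 1)"
    using assms
    by (intro integral_mono measure_pmf.integrable_const_bound[where B = 1])
       (auto simp: norm_power power_le_one)
  finally show ?thesis by simp
qed

text \<open>Dominated by 1, including on the boundary circle. For the queue itself this is all that
  is known at 1 before the continuation is built.\<close>

lemma continuous_on_pmf_gf: "continuous_on (cball 0 1) (pmf_gf p)"
proof -
  have "continuous_on (cball 0 1) (\<lambda>z::complex. measure_pmf.expectation p (\<lambda>k. z ^ k))"
    by (rule continuous_on_LINT_pmf[where B = 1])
       (auto intro!: continuous_intros simp: norm_power power_le_one)
  then show ?thesis
    by (rule continuous_on_eq) (simp add: pmf_gf_eq_expectation)
qed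

lemma pmf_gf_of_real:
  assumes "0 \<le> x" "x \<le> 1"
  shows "(\<lambda>k. pmf p k * x ^ k) sums Re (pmf_gf p (of_real x))"
    and "pmf_gf p (of_real x) = of_real (Re (pmf_gf p (of_real x)))"
proof -
  have s: "summable (\<lambda>k. pmf p k * x ^ k)"
    using summable_pmf_disk[of "of_real x" p] assms by (simp add: norm_power)
  have "(\<lambda>k. of_real (pmf p k * x ^ k)) sums (of_real (\<Sum>k. pmf p k * x ^ k) :: complex)"
    using s by (intro sums_of_real summable_sums)
  then have "pmf_gf p (of_real x) = of_real (\<Sum>k. pmf p k * x ^ k)"
    by (simp add: pmf_gf_def sums_iff)
  with s show "(\<lambda>k. pmf p k * x ^ k) sums Re (pmf_gf p (of_real x))"
    and "pmf_gf p (of_real x) = of_real (Re (pmf_gf p (of_real x)))"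
    by (simp_all add: sums_iff)
qed

lemma pmf_le_pmf_gf:
  assumes "0 \<le> x" "x \<le> 1"
  shows "pmf p k * x ^ k \<le> Re (pmf_gf p (of_real x))"
  using pmf_gf_of_real(1)[OF assms, of p] assms
    sum_le_suminf[of "\<lambda>k. pmf p k * x ^ k" "{k}"]
  by (auto simp: sums_iff)

lemma pmf_gf_pos:
  assumes "0 < x" "x \<le> 1"
  shows "0 < Re (pmf_gf p (of_real x))"
proof -
  obtain k where "k \<in> set_pmf p" using set_pmf_not_empty[of p] by blast
  then have "0 < pmf p k * x ^ k" using assms by (simp add: pmf_positive)
  also have "\<dots> \<le> Re (pmf_gf p (of_real x))" using assms by (intro pmf_le_pmf_gf) auto
  finally show ?thesis .
qed

section \<open>Higher derivatives and factorial moments\<close>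

text \<open>The factor (k + n)! / k! is written with a binomial coefficient so that at argument 1
  the coefficients turn into factorial moments.\<close>

lemma diffs_funpow:
  fixes c :: "nat \<Rightarrow> 'a::comm_ring_1"
  shows "(diffs ^^ n) c k = of_nat (fact n * ((k + n) choose n)) * c (k + n)"
proof (induction n arbitrary: k)
  case (Suc n)
  have "Suc k * (fact n * ((Suc k + n) choose n)) = fact (Suc n) * ((k + Suc n) choose Suc n)"
  proof -
    have "Suc k * (fact n * ((Suc k + n) choose n)) = fact n * (Suc k * (Suc (n + k) choose n))"
      by (simp add: mult.left_commute add.commute)
    also have "\<dots> = fact n * (Suc n * (Suc (n + k) choose Suc n))"
      by (simp only: Suc_times_binomial_add)
    also have "\<dots> = fact (Suc n) * ((k + Suc n) choose Suc n)"
      by (simp only: fact_Suc ac_simps add_Suc add_Suc_right of_nat_id)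
    finally show ?thesis .
  qed
  note arith = this
  have "(diffs ^^ Suc n) c k = of_nat (Suc k) * (diffs ^^ n) c (Suc k)"
    unfolding funpow.simps o_apply by (subst diffs_def) (rule refl)
  also have "\<dots> = of_nat (Suc k * (fact n * ((Suc k + n) choose n))) * c (Suc k + n)"
    by (simp only: Suc.IH of_nat_mult mult.assoc)
  finally show ?case unfolding arith by simp
qed simp

text \<open>Both claims are proved in one induction: differentiating the n-th series termwise
  requires its summability throughout the disk.\<close>

lemma powser_higher_deriv:
  fixes c :: "nat \<Rightarrow> complex"
  assumes c: "\<And>z. norm z < R \<Longrightarrow> summable (\<lambda>k. c k * z ^ k)" and "norm z < R"
  shows "summable (\<lambda>k. (diffs ^^ n) c k * z ^ k)"
    and "(deriv ^^ n) (\<lambda>z. \<Sum>k. c k * z ^ k) z = (\<Sum>k. (diffs ^^ n) c k * z ^ k)"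
  using \<open>norm z < R\<close>
proof (induction n arbitrary: z)
  case (Suc n)
  {
    case 1
    \<comment> \<open>Summability of the differentiated series at \<open>z\<close> is derived from
      convergence on a slightly larger disk, hence the intermediate radius.\<close>
    obtain K where K: "norm z < K" "K < R" using 1 dense by blast
    have "summable (\<lambda>k. diffs ((diffs ^^ n) c) k * z ^ k)"
    proof (rule termdiff_converges[where K = K])
      show "summable (\<lambda>k. (diffs ^^ n) c k * x ^ k)" if "norm x < K" for x
        using Suc.IH(1) K that by simp
    qed (use K in auto)
    then show ?case by simp
  next
    case 2
    have "((\<lambda>z. \<Sum>k. (diffs ^^ n) c k * z ^ k) has_field_derivative
        (\<Sum>k. diffs ((diffs ^^ n) c) k * z ^ k)) (at z)"
      using Suc.IH(1) 2 by (intro termdiffs_strong'[where K = R]) auto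
    then have "((deriv ^^ n) (\<lambda>z. \<Sum>k. c k * z ^ k) has_field_derivative
        (\<Sum>k. diffs ((diffs ^^ n) c) k * z ^ k)) (at z)"
      by (rule has_field_derivative_transform_within_open[where S = "ball 0 R"])
         (use 2 Suc.IH(2) in auto)
    then show ?case by (simp add: DERIV_imp_deriv)
  }
qed (use c in auto)

lemma pmf_gf_higher_deriv:
  assumes "\<And>z. norm z < R \<Longrightarrow> summable (\<lambda>k. pmf p k * norm (z ^ k :: complex))" "norm z < R"
  shows "summable (\<lambda>k. (diffs ^^ n) (\<lambda>k. of_real (pmf p k)) k * z ^ k)"
    and "(deriv ^^ n) (pmf_gf p) z = (\<Sum>k. (diffs ^^ n) (\<lambda>k. of_real (pmf p k)) k * z ^ k)"
proof -
  have *: "summable (\<lambda>k. of_real (pmf p k) * z ^ k)" if "norm z < R" for z :: complex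
    using pmf_gf_sums(1)[OF assms(1)[OF that]] by (rule sums_summable)
  show "summable (\<lambda>k. (diffs ^^ n) (\<lambda>k. of_real (pmf p k)) k * z ^ k)"
    using * assms(2) by (rule powser_higher_deriv)
  have "pmf_gf p = (\<lambda>z. \<Sum>k. of_real (pmf p k) * z ^ k)"
    by (simp add: fun_eq_iff pmf_gf_def)
  then show "(deriv ^^ n) (pmf_gf p) z = (\<Sum>k. (diffs ^^ n) (\<lambda>k. of_real (pmf p k)) k * z ^ k)"
    using powser_higher_deriv(2)[OF *, of R z n] assms(2) by simp
qed

lemma pmf_gf_holomorphic:
  assumes "\<And>z. norm z < R \<Longrightarrow> summable (\<lambda>k. pmf p k * norm (z ^ k :: complex))"
  shows "pmf_gf p holomorphic_on ball 0 R"
proof (rule power_series_holomorphic)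
  fix w :: complex assume "w \<in> ball 0 R"
  then show "(\<lambda>k. of_real (pmf p k) * (w - 0) ^ k) sums pmf_gf p w"
    using pmf_gf_sums(1)[OF assms[of w]] by simp
qed

text \<open>The two series differ by a shift of the index by \<open>n\<close>; the \<open>n\<close>
  terms gained on the right vanish because \<open>k choose n\<close> is 0 for
  \<open>k < n\<close>.\<close>

lemma factorial_moment_sums_shift:
  fixes a :: "nat \<Rightarrow> real"
  shows "(\<lambda>k. (diffs ^^ n) a k) sums L \<longleftrightarrow> (\<lambda>k. a k * (fact n * real (k choose n))) sums L"
proof -
  have "(\<lambda>k. (diffs ^^ n) a k) = (\<lambda>k. a (k + n) * (fact n * real ((k + n) choose n)))"
    by (simp add: diffs_funpow fun_eq_iff)
  moreover have "(\<Sum>k<n. a k * (fact n * real (k choose n))) = 0"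
    by (intro sum.neutral) (auto simp: binomial_eq_0)
  ultimately show ?thesis
    using sums_iff_shift[of "\<lambda>k. a k * (fact n * real (k choose n))" n L] by simp
qed

lemma factorial_moment:
  assumes "(\<lambda>k. (diffs ^^ n) (pmf p) k) sums L"
  shows "integrable (measure_pmf p) (\<lambda>k. fact n * real (k choose n))"
    and "measure_pmf.expectation p (\<lambda>k. fact n * real (k choose n)) = L"
proof -
  have s: "(\<lambda>k. pmf p k * (fact n * real (k choose n))) sums L"
    using assms by (simp add: factorial_moment_sums_shift)
  then have "summable (\<lambda>k. pmf p k * norm (fact n * real (k choose n)))"
    by (simp add: sums_iff)
  note * = pmf_nat_expectation[OF this]
  show "integrable (measure_pmf p) (\<lambda>k. fact n * real (k choose n))" by (rule *(1))
  show "measure_pmf.expectation p (\<lambda>k. fact n * real (k choose n)) = L"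
    using *(2) s by (simp add: sums_iff)
qed

lemma diffs_funpow_of_real:
  "(diffs ^^ n) (\<lambda>k. complex_of_real (a k)) k = of_real ((diffs ^^ n) a k)"
  by (simp add: diffs_funpow)

text \<open>A converse of Abel's theorem for nonnegative coefficients. Partial sums at
  \<open>x\<close> stay below the full sum, so letting \<open>x\<close> tend to 1 bounds them by
  \<open>L\<close>; conversely \<open>a k * x ^ k \<le> a k\<close>. Convergence at 1 is thus part
  of the conclusion, which later yields finiteness of the queue moments.\<close>

lemma nonneg_powser_sums_left_limit:
  fixes a :: "nat \<Rightarrow> real"
  assumes a: "\<And>k. 0 \<le> a k"
    and s: "\<And>x. 0 \<le> x \<Longrightarrow> x < 1 \<Longrightarrow> summable (\<lambda>k. a k * x ^ k)"
    and L: "((\<lambda>x. \<Sum>k. a k * x ^ k) \<longlongrightarrow> L) (at_left 1)"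
  shows "a sums L"
proof -
  have ev: "\<forall>\<^sub>F x in at_left (1::real). 0 < x \<and> x < 1"
    using eventually_at_left_real[of 0 "1::real"] by simp
  have partial: "(\<Sum>k<n. a k) \<le> L" for n
  proof (rule tendsto_le[OF _ L])
    have "((\<lambda>x. \<Sum>k<n. a k * x ^ k) \<longlongrightarrow> (\<Sum>k<n. a k * 1 ^ k)) (at_left 1)"
      by (intro tendsto_intros)
    then show "((\<lambda>x. \<Sum>k<n. a k * x ^ k) \<longlongrightarrow> (\<Sum>k<n. a k)) (at_left 1)" by simp
    show "\<forall>\<^sub>F x in at_left 1. (\<Sum>k<n. a k * x ^ k) \<le> (\<Sum>k. a k * x ^ k)"
      using ev by eventually_elim (intro sum_le_suminf s, auto simp: a)
  qed simp
  have sum: "summable a"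
  proof (rule summableI_nonneg_bounded[where x = L])
  qed (auto simp: a partial)
  have "suminf a \<le> L" by (rule suminf_le_const[OF sum partial])
  moreover have "L \<le> suminf a"
  proof (rule tendsto_upperbound[OF L])
    show "\<forall>\<^sub>F x in at_left 1. (\<Sum>k. a k * x ^ k) \<le> suminf a"
      using ev
    proof eventually_elim
      case (elim x)
      then have "a k * x ^ k \<le> a k" for k
        using mult_left_mono[OF power_le_one[of x k] a[of k]] by simp
      then show ?case using elim by (intro suminf_le s sum) auto
    qed
  qed simp
  ultimately show ?thesis using sum by (simp add: sums_iff)
qed

lemma fact_times_choose_real:
  "fact 1 * real (k choose 1) = real k"
  "fact 2 * real (k choose 2) = real k * (real k - 1)"
  "fact 3 * real (k choose 3) = real k * (real k - 1) * (real k - 2)"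
  by (simp_all add: binomial_gbinomial gbinomial_prod_rev numeral_eq_Suc)

lemma pmf_gf_factorial_moment:
  assumes r: "1 < r" "summable (\<lambda>k. pmf p k * r ^ k)"
  shows "integrable (measure_pmf p) (\<lambda>k. fact n * real (k choose n))"
    and "(deriv ^^ n) (pmf_gf p) 1 = of_real (measure_pmf.expectation p (\<lambda>k. fact n * real (k choose n)))"
proof -
  note * = pmf_gf_higher_deriv[of r p 1 n, OF summable_pmf_gf[OF r(2)]]
  have s: "summable (\<lambda>k. (diffs ^^ n) (pmf p) k)"
    using *(1) r(1) by (simp add: diffs_funpow_of_real summable_complex_of_real)
  then have m: "(\<lambda>k. (diffs ^^ n) (pmf p) k) sums (\<Sum>k. (diffs ^^ n) (pmf p) k)"
    by (rule summable_sums)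
  show "integrable (measure_pmf p) (\<lambda>k. fact n * real (k choose n))"
    by (rule factorial_moment[OF m])
  show "(deriv ^^ n) (pmf_gf p) 1 = of_real (measure_pmf.expectation p (\<lambda>k. fact n * real (k choose n)))"
    using *(2) r(1) factorial_moment(2)[OF m] suminf_of_real[OF s, where 'a = complex]
    by (simp add: diffs_funpow_of_real)
qed

lemma central_moments_via_factorial_moments:
  fixes p :: "nat pmf"
  defines "m \<equiv> measure_pmf.expectation p real"
  assumes int: "\<And>n. n \<le> 3 \<Longrightarrow> integrable (measure_pmf p) (\<lambda>k. fact n * real (k choose n))"
  shows "measure_pmf.expectation p (\<lambda>k. fact 1 * real (k choose 1)) = m"
    and "measure_pmf.expectation p (\<lambda>k. fact 2 * real (k choose 2)) =
      measure_pmf.expectation p (\<lambda>k. (real k - m) ^ 2) + m ^ 2 - m"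
    and "measure_pmf.expectation p (\<lambda>k. fact 3 * real (k choose 3)) =
      measure_pmf.expectation p (\<lambda>k. (real k - m) ^ 3)
      + 3 * m * measure_pmf.expectation p (\<lambda>k. (real k - m) ^ 2) + m ^ 3
      - 3 * (measure_pmf.expectation p (\<lambda>k. (real k - m) ^ 2) + m ^ 2) + 2 * m"
proof -
  have i1: "integrable (measure_pmf p) real"
    using int[of 1] by (simp only: fact_times_choose_real)
  have f2: "integrable (measure_pmf p) (\<lambda>k. real k * (real k - 1))"
    using int[of 2] by (simp only: fact_times_choose_real)
  have f3: "integrable (measure_pmf p) (\<lambda>k. real k * (real k - 1) * (real k - 2))"
    using int[of 3] by (simp only: fact_times_choose_real)
  have i2: "integrable (measure_pmf p) (\<lambda>k. real k ^ 2)"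
    using Bochner_Integration.integrable_add[OF f2 i1] by (simp add: algebra_simps power2_eq_square)
  \<comment> \<open>Uses k^3 = k(k-1)(k-2) + 3k(k-1) + k.\<close>
  have i3: "integrable (measure_pmf p) (\<lambda>k. real k ^ 3)"
    using Bochner_Integration.integrable_add[OF Bochner_Integration.integrable_add[OF f3
          Bochner_Integration.integrable_mult_right[OF f2, of 3]] i1]
    by (simp add: algebra_simps power3_eq_cube)
  note ii = i1 i2 i3
  let ?E = "measure_pmf.expectation p"
  show "?E (\<lambda>k. fact 1 * real (k choose 1)) = m"
    by (simp only: fact_times_choose_real m_def)
  have e2: "?E (\<lambda>k. real k * (real k - 1)) = ?E (\<lambda>k. real k ^ 2) - m"
    using ii by (simp add: algebra_simps flip: power2_eq_square m_def)
  have v: "?E (\<lambda>k. (real k - m) ^ 2) = ?E (\<lambda>k. real k ^ 2) - m ^ 2"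
  proof -
    have "?E (\<lambda>k. (real k - m) ^ 2) = ?E (\<lambda>k. real k ^ 2 - 2 * m * real k + m ^ 2)"
      by (simp add: power2_diff algebra_simps)
    also have "\<dots> = ?E (\<lambda>k. real k ^ 2) - m ^ 2"
      using ii by (simp add: power2_eq_square flip: m_def)
    finally show ?thesis .
  qed
  show "?E (\<lambda>k. fact 2 * real (k choose 2)) = ?E (\<lambda>k. (real k - m) ^ 2) + m ^ 2 - m"
    by (simp only: fact_times_choose_real e2 v)
  have e3: "?E (\<lambda>k. real k * (real k - 1) * (real k - 2)) = ?E (\<lambda>k. real k ^ 3) - 3 * ?E (\<lambda>k. real k ^ 2) + 2 * m"
  proof -
    have "?E (\<lambda>k. real k * (real k - 1) * (real k - 2)) = ?E (\<lambda>k. real k ^ 3 - 3 * real k ^ 2 + 2 * real k)"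
      by (simp add: power2_eq_square power3_eq_cube algebra_simps)
    also have "\<dots> = ?E (\<lambda>k. real k ^ 3) - 3 * ?E (\<lambda>k. real k ^ 2) + 2 * m"
      using ii by (simp flip: m_def)
    finally show ?thesis .
  qed
  have c: "?E (\<lambda>k. (real k - m) ^ 3) = ?E (\<lambda>k. real k ^ 3) - 3 * m * ?E (\<lambda>k. real k ^ 2) + 2 * m ^ 3"
  proof -
    have "?E (\<lambda>k. (real k - m) ^ 3) = ?E (\<lambda>k. real k ^ 3 - 3 * m * real k ^ 2 + 3 * m ^ 2 * real k - m ^ 3)"
      by (simp add: power2_eq_square power3_eq_cube algebra_simps)
    also have "\<dots> = ?E (\<lambda>k. real k ^ 3) - 3 * m * ?E (\<lambda>k. real k ^ 2) + 2 * m ^ 3"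
      using ii by (simp add: power2_eq_square power3_eq_cube flip: m_def)
    finally show ?thesis .
  qed
  show "?E (\<lambda>k. fact 3 * real (k choose 3)) = ?E (\<lambda>k. (real k - m) ^ 3)
      + 3 * m * ?E (\<lambda>k. (real k - m) ^ 2) + m ^ 3 - 3 * (?E (\<lambda>k. (real k - m) ^ 2) + m ^ 2) + 2 * m"
    by (simp only: fact_times_choose_real e3 v c) (simp add: power2_eq_square power3_eq_cube algebra_simps)
qed

lemma pmf_gf_derivs_at_1:
  fixes p :: "nat pmf"
  assumes r: "1 < r" "summable (\<lambda>k. pmf p k * r ^ k)"
  defines "m \<equiv> measure_pmf.expectation p real"
  defines "v \<equiv> measure_pmf.expectation p (\<lambda>k. (real k - m) ^ 2)"
  defines "c \<equiv> measure_pmf.expectation p (\<lambda>k. (real k - m) ^ 3)"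
  shows "deriv (pmf_gf p) 1 = of_real m"
    and "(deriv ^^ 2) (pmf_gf p) 1 = of_real (v + m ^ 2 - m)"
    and "(deriv ^^ 3) (pmf_gf p) 1 = of_real (c + 3 * m * v + m ^ 3 - 3 * (v + m ^ 2) + 2 * m)"
  using pmf_gf_factorial_moment(2)[OF r, of 1] pmf_gf_factorial_moment(2)[OF r, of 2]
    pmf_gf_factorial_moment(2)[OF r, of 3]
  unfolding central_moments_via_factorial_moments[OF pmf_gf_factorial_moment(1)[OF r]]
    m_def v_def c_def
  by simp_all

text \<open>Equality case of the triangle inequality. With \<alpha> = E w^X, the nonnegative
  variable 1 - Re (cnj \<alpha> w^X) has mean 1 - |\<alpha>|^2 = 0, so w^X = \<alpha> almost surely;
  then E (X w^X) = \<alpha> E X.\<close>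

lemma pmf_gf_norm_1_imp_deriv:
  assumes r: "1 < r" "summable (\<lambda>k. pmf p k * r ^ k)"
    and w: "norm w = 1" "norm (pmf_gf p w) = 1"
  shows "w * deriv (pmf_gf p) w = pmf_gf p w * of_real (measure_pmf.expectation p real)"
proof -
  define \<alpha> where "\<alpha> = pmf_gf p w"
  have intw: "integrable (measure_pmf p) (\<lambda>k. w ^ k)"
    using w by (intro measure_pmf.integrable_const_bound[where B = 1]) (auto simp: norm_power)
  have le: "Re (cnj \<alpha> * w ^ k) \<le> 1" for k
    using complex_Re_le_cmod[of "cnj \<alpha> * w ^ k"] w by (simp add: norm_mult norm_power \<alpha>_def)
  have int: "integrable (measure_pmf p) (\<lambda>k. 1 - Re (cnj \<alpha> * w ^ k))"
    using intw by (intro Bochner_Integration.integrable_diff integrable_Re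
        Bochner_Integration.integrable_mult_right) auto
  have "measure_pmf.expectation p (\<lambda>k. 1 - Re (cnj \<alpha> * w ^ k)) =
      1 - Re (cnj \<alpha> * measure_pmf.expectation p (\<lambda>k. w ^ k))"
    using intw by (subst Bochner_Integration.integral_diff) (auto simp del: times_complex.sel simp: integral_Re)
  also have "\<dots> = 1 - Re (cnj \<alpha> * \<alpha>)"
    using w by (simp add: \<alpha>_def pmf_gf_eq_expectation)
  also have "\<dots> = 0"
    using w(2) complex_norm_square[of \<alpha>] by (simp add: \<alpha>_def mult.commute)
  finally have "AE k in measure_pmf p. 1 - Re (cnj \<alpha> * w ^ k) = 0"
    using integral_nonneg_eq_0_iff_AE[OF int] le by simp
  then have eq: "w ^ k = \<alpha>" if "k \<in> set_pmf p" for k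
  proof -
    have "Re (cnj \<alpha> * w ^ k) = 1"
      using \<open>AE k in _. _\<close> that by (auto simp: AE_measure_pmf_iff)
    moreover have "norm (cnj \<alpha> * w ^ k) = 1"
      using w by (simp add: norm_mult norm_power \<alpha>_def)
    ultimately have "cnj \<alpha> * w ^ k = 1"
      using cmod_power2[of "cnj \<alpha> * w ^ k"] by (simp add: complex_eq_iff del: times_complex.sel)
    then have "\<alpha> * cnj \<alpha> * w ^ k = \<alpha>" by (simp only: mult.assoc mult_1_right)
    moreover have "\<alpha> * cnj \<alpha> = 1"
      using w(2) complex_norm_square[of \<alpha>] by (simp add: \<alpha>_def)
    ultimately show ?thesis by (simp only: mult_1_left)
  qed
  note hd = pmf_gf_higher_deriv[of r p w 1, OF summable_pmf_gf[OF r(2)]]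
  have "(\<lambda>k. of_nat k * of_real (pmf p k) * w ^ (k - Suc 0)) sums deriv (pmf_gf p) w"
  proof -
    have *: "(\<lambda>k. diffs (\<lambda>k. of_real (pmf p k)) k * w ^ k) sums deriv (pmf_gf p) w"
      using hd r(1) w by (simp add: sums_iff)
    show ?thesis
      using diffs_equiv[OF sums_summable[OF *]] by (simp only: sums_unique[OF *])
  qed
  from sums_mult[OF this, of w]
  have "(\<lambda>k. \<alpha> * of_real (real k * pmf p k)) sums (w * deriv (pmf_gf p) w)"
  proof (rule sums_cong[THEN iffD1, rotated])
    fix k
    \<comment> \<open>Off the support and for \<open>k = 0\<close> both sides are 0; otherwise the
      powers combine to \<open>w ^ k\<close>, which equals \<open>\<alpha>\<close>.\<close>
    show "w * (of_nat k * of_real (pmf p k) * w ^ (k - Suc 0)) = \<alpha> * of_real (real k * pmf p k)"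
      using eq[of k] by (cases "k \<in> set_pmf p"; cases k) (auto simp: set_pmf_iff)
  qed
  moreover have "(\<lambda>k. \<alpha> * of_real (real k * pmf p k)) sums (\<alpha> * of_real (measure_pmf.expectation p real))"
  proof (intro sums_mult sums_of_real)
    have "summable (\<lambda>k. (diffs ^^ 1) (pmf p) k)"
      using pmf_gf_higher_deriv(1)[of r p 1 1, OF summable_pmf_gf[OF r(2)]] r(1)
      by (simp only: diffs_funpow_of_real) (simp add: summable_complex_of_real)
    from factorial_moment_sums_shift[THEN iffD1, OF summable_sums[OF this]]
    have "summable (\<lambda>k. pmf p k * norm (real k))" by (simp add: sums_iff)
    from pmf_nat_expectation(2)[OF this]
    show "(\<lambda>k. real k * pmf p k) sums measure_pmf.expectation p real" by (simp add: mult.commute)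
  qed
  ultimately show ?thesis unfolding \<alpha>_def by (rule sums_unique2)
qed

section \<open>Roots and factors\<close>

text \<open>Boundedness gives integrability at both levels; the real and imaginary parts are treated
  separately by the rule for real integrands.\<close>

lemma expectation_bind_pmf_bounded:
  fixes f :: "'b \<Rightarrow> complex"
  assumes f: "\<And>x. norm (f x) \<le> B"
  shows "measure_pmf.expectation (bind_pmf p g) f =
    measure_pmf.expectation p (\<lambda>x. measure_pmf.expectation (g x) f)"
proof -
  have real: "measure_pmf.expectation (bind_pmf p g) h =
      measure_pmf.expectation p (\<lambda>x. measure_pmf.expectation (g x) h)"
    if "\<And>x. \<bar>h x\<bar> \<le> B" for h :: "'b \<Rightarrow> real"
    unfolding measure_pmf_bind
    using that measurable_measure_pmf[of g]
    by (intro integral_bind[where K = "count_space UNIV" and B' = 1 and B = B])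
       (auto simp: measure_pmf.emeasure_space_1 measure_pmf.finite_measure_axioms)
  have int: "integrable (measure_pmf q) f" for q
    using f by (intro measure_pmf.integrable_const_bound[where B = B]) auto
  have int2: "integrable (measure_pmf p) (\<lambda>x. measure_pmf.expectation (g x) f)"
  proof (rule measure_pmf.integrable_const_bound[where B = B])
    have "norm (measure_pmf.expectation q f) \<le> B" for q
    proof -
      have "norm (measure_pmf.expectation q f) \<le> measure_pmf.expectation q (\<lambda>x. norm (f x))"
        by (rule integral_norm_bound)
      also have "\<dots> \<le> measure_pmf.expectation q (\<lambda>x. B)"
        using f int by (intro integral_mono) auto
      finally show ?thesis by simp
    qed
    then show "AE x in measure_pmf p. norm (measure_pmf.expectation (g x) f) \<le> B" by simp
  qed simp
  have "\<bar>Re (f x)\<bar> \<le> B" "\<bar>Im (f x)\<bar> \<le> B" for x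
    using f[of x] abs_Re_le_cmod[of "f x"] abs_Im_le_cmod[of "f x"] by linarith+
  from real[of "\<lambda>x. Re (f x)", OF this(1)] real[of "\<lambda>x. Im (f x)", OF this(2)] show ?thesis
    using int int2 by (simp add: complex_eq_iff)
qed

text \<open>Once equal roots are grouped, each exponent is at most the order of that root in
  \<open>p\<close>, so the product divides the complete factorization of \<open>p\<close> over the
  complex numbers.\<close>

lemma prod_roots_dvd:
  fixes p :: "complex poly" and z :: "nat \<Rightarrow> complex"
  assumes "p \<noteq> 0"
    and dvd: "\<And>w. w \<in> z ` {..<m} \<Longrightarrow> [:-w, 1:] ^ card {i. i < m \<and> z i = w} dvd p"
  shows "(\<Prod>i<m. [:-z i, 1:]) dvd p"
proof -
  have card: "card {i \<in> {..<m}. z i = w} \<le> order w p" if "w \<in> z ` {..<m}" for w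
    using dvd[OF that] assms(1) by (simp add: order_divides)
  have "(\<Prod>i<m. [:-z i, 1:]) = (\<Prod>w\<in>z ` {..<m}. \<Prod>i\<in>{i \<in> {..<m}. z i = w}. [:-z i, 1:])"
    by (rule prod.image_gen) simp
  also have "\<dots> = (\<Prod>w\<in>z ` {..<m}. [:-w, 1:] ^ card {i \<in> {..<m}. z i = w})"
    by (intro prod.cong refl) simp
  also have "\<dots> dvd (\<Prod>w | poly p w = 0. [:-w, 1:] ^ order w p)"
  proof (rule prod_dvd_prod_subset2)
    show "finite {w. poly p w = 0}" using assms(1) by (rule poly_roots_finite)
    show "z ` {..<m} \<subseteq> {w. poly p w = 0}"
    proof safe
      fix i assume "i < m"
      then have "0 < card {j \<in> {..<m}. z j = z i}" by (auto simp: card_gt_0_iff)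
      also have "\<dots> \<le> order (z i) p" using \<open>i < m\<close> by (intro card) auto
      finally show "poly p (z i) = 0" using assms(1) by (simp add: order_root)
    qed
    show "[:-w, 1:] ^ card {i \<in> {..<m}. z i = w} dvd [:-w, 1:] ^ order w p"
      if "w \<in> z ` {..<m}" for w
      by (intro le_imp_power_dvd card that)
  qed
  also have "\<dots> dvd p"
    using complex_poly_decompose[of p] by (metis dvd_smult dvd_refl)
  finally show ?thesis .
qed

text \<open>Transfers a zero of an analytic function to a polynomial with its multiplicity. In the
  application \<open>h\<close> contains the nonvanishing cofactor of \<open>F\<close> and the
  generating function of the queue, and \<open>k\<close> is that of the arrivals.\<close>

lemma root_power_dvd_poly:
  fixes q :: "complex poly"
  assumes lim: "isCont h w" "isCont k w" "k w \<noteq> 0"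
    and eq: "\<forall>\<^sub>F v in at w. h v * (v - w) ^ n = k v * poly q v"
  shows "[:-w, 1:] ^ n dvd q"
proof (cases "q = 0")
  case False
  obtain q' where q': "q = [:-w, 1:] ^ order w q * q'" "\<not> [:-w, 1:] dvd q'"
    using order_decomp[OF False, of w] by auto
  have "n \<le> order w q"
  proof (rule ccontr)
    assume "\<not> n \<le> order w q"
    define j where "j = order w q"
    have j: "j < n" using \<open>\<not> n \<le> order w q\<close> by (simp add: j_def)
    \<comment> \<open>Away from \<open>w\<close> the common power can be cancelled. A positive power
      remains on the left, so in the limit \<open>k w * poly q' w = 0\<close>, although neither
      factor vanishes.\<close>
    have "\<forall>\<^sub>F v in at w. h v * (v - w) ^ (n - j) = k v * poly q' v"
      using eq eventually_neq_at_within[of w w UNIV]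
    proof eventually_elim
      case (elim v)
      have "(v - w) ^ n = (v - w) ^ j * (v - w) ^ (n - j)"
        using j by (simp flip: power_add)
      moreover have "poly q v = (v - w) ^ j * poly q' v"
        by (subst q'(1)) (simp add: j_def)
      ultimately have "(v - w) ^ j * (h v * (v - w) ^ (n - j)) = (v - w) ^ j * (k v * poly q' v)"
        using elim(1) by (simp add: ac_simps)
      then show ?case using elim(2) by simp
    qed
    then have "((\<lambda>v. k v * poly q' v) \<longlongrightarrow> h w * (w - w) ^ (n - j)) (at w)"
      if "((\<lambda>v. h v * (v - w) ^ (n - j)) \<longlongrightarrow> h w * (w - w) ^ (n - j)) (at w)"
      using that by (rule Lim_transform_eventually[rotated])
    moreover have "((\<lambda>v. h v * (v - w) ^ (n - j)) \<longlongrightarrow> h w * (w - w) ^ (n - j)) (at w)"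
      using lim by (intro tendsto_intros) (auto simp: isCont_def)
    moreover have "((\<lambda>v. k v * poly q' v) \<longlongrightarrow> k w * poly q' w) (at w)"
      using lim by (intro tendsto_intros) (auto simp: isCont_def)
    ultimately have "h w * (w - w) ^ (n - j) = k w * poly q' w"
      by (blast intro: tendsto_unique[OF at_neq_bot])
    then have "poly q' w = 0" using j lim(3) by (simp add: power_0_left)
    then show False using q'(2) by (simp add: poly_eq_0_iff_dvd)
  qed
  then show ?thesis using q'(1) by (metis dvd_triv_left le_imp_power_dvd dvd_trans)
qed simp

text \<open>Logarithmic differentiation: p'/p is the sum of the 1 / (w - z_i), and p''/p = (p'/p)^2
  + (p'/p)'.\<close>

lemma higher_deriv_prod_linear:
  fixes z :: "'i \<Rightarrow> complex"
  assumes "finite I" "\<And>i. i \<in> I \<Longrightarrow> z i \<noteq> w"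
  defines "p \<equiv> \<lambda>v. \<Prod>i\<in>I. (v - z i)"
  shows "deriv p w = p w * (\<Sum>i\<in>I. 1 / (w - z i))"
    and "(deriv ^^ 2) p w = p w * ((\<Sum>i\<in>I. 1 / (w - z i))\<^sup>2 - (\<Sum>i\<in>I. 1 / (w - z i)\<^sup>2))"
proof -
  have "deriv p w = p w * (\<Sum>i\<in>I. 1 / (w - z i)) \<and>
    (deriv ^^ 2) p w = p w * ((\<Sum>i\<in>I. 1 / (w - z i))\<^sup>2 - (\<Sum>i\<in>I. 1 / (w - z i)\<^sup>2))"
    using assms(1,2) unfolding p_def
  proof (induction I rule: finite_induct)
    case empty
    then show ?case by (simp add: numeral_2_eq_2)
  next
    case (insert j I)
    let ?p = "\<lambda>v. \<Prod>i\<in>I. (v - z i)"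
    have hol: "(\<lambda>v. v - z j) holomorphic_on UNIV" "?p holomorphic_on UNIV"
      by (intro holomorphic_intros)+
    note hd = higher_deriv_mult[OF hol open_UNIV UNIV_I, of _ w]
    have lin: "deriv (\<lambda>v. v - z j) = (\<lambda>_. 1)"
      by (rule ext, rule DERIV_imp_deriv) (auto intro!: derivative_eq_intros)
    have ne: "w - z j \<noteq> 0" using insert by auto
    have prod: "(\<lambda>v. \<Prod>i\<in>insert j I. (v - z i)) = (\<lambda>v. (v - z j) * ?p v)"
      using insert by (simp add: fun_eq_iff)
    have IH: "deriv ?p w = ?p w * (\<Sum>i\<in>I. 1 / (w - z i))"
      "(deriv ^^ 2) ?p w = ?p w * ((\<Sum>i\<in>I. 1 / (w - z i))\<^sup>2 - (\<Sum>i\<in>I. 1 / (w - z i)\<^sup>2))"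
      using insert by auto
    have d1: "deriv (\<lambda>v. (v - z j) * ?p v) w = (w - z j) * deriv ?p w + ?p w"
      using hd[of 1] by (simp add: lin)
    have d2: "(deriv ^^ 2) (\<lambda>v. (v - z j) * ?p v) w = (w - z j) * (deriv ^^ 2) ?p w + 2 * deriv ?p w"
      using hd[of 2] by (simp add: lin numeral_2_eq_2)
    show ?case
      unfolding prod d1 d2 IH using insert(1,2) ne
      by (simp add: power2_eq_square divide_simps) (simp add: algebra_simps)
  qed
  then show "deriv p w = p w * (\<Sum>i\<in>I. 1 / (w - z i))"
    and "(deriv ^^ 2) p w = p w * ((\<Sum>i\<in>I. 1 / (w - z i))\<^sup>2 - (\<Sum>i\<in>I. 1 / (w - z i)\<^sup>2))"
    by auto
qed

lemma tendsto_at_left_1_complex: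
  assumes "isCont f (1 :: complex)"
  shows "((\<lambda>x. f (of_real x)) \<longlongrightarrow> f 1) (at_left (1 :: real))"
proof -
  have "((\<lambda>x::real. complex_of_real x) \<longlongrightarrow> of_real 1) (at_left 1)"
    by (intro tendsto_intros)
  then show ?thesis using isCont_tendsto_compose[OF assms] by simp
qed

lemma zorder_factorization:
  assumes "f holomorphic_on S" "open S" "connected S" "w \<in> S" "\<exists>v\<in>S. f v \<noteq> 0"
  obtains \<rho> where "0 < \<rho>" "cball w \<rho> \<subseteq> S" "zor_poly f w holomorphic_on cball w \<rho>"
    "\<And>v. v \<in> cball w \<rho> \<Longrightarrow> f v = zor_poly f w v * (v - w) ^ nat (zorder f w)"
    "\<And>v. v \<in> cball w \<rho> \<Longrightarrow> zor_poly f w v \<noteq> 0"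
proof -
  obtain \<rho> where \<rho>: "0 < \<rho> \<and> cball w \<rho> \<subseteq> S \<and> zor_poly f w holomorphic_on cball w \<rho> \<and>
      (\<forall>v\<in>cball w \<rho>. f v = zor_poly f w v * (v - w) ^ nat (zorder f w) \<and> zor_poly f w v \<noteq> 0)"
    using conjunct2[OF zorder_exist_zero[OF assms]] by (rule exE)
  show ?thesis
    by (rule that[of \<rho>]) (use \<rho> in blast)+
qed

lemma pderiv_sum: "pderiv (sum f A) = (\<Sum>i\<in>A. pderiv (f i))"
  by (induction A rule: infinite_finite_induct) (simp_all add: pderiv_add)

section \<open>Algebra from derivatives at 1 to mean and variance\<close>

text \<open>Here \<open>f2\<close> stands for F''(1), \<open>R1\<close> for the mean of the queue
  and \<open>\<sigma>1\<close> for the root sum. The last hypothesis is the first derivative at 1 of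
  R F1 = Y c prod (z - z_i), with F1(1) = \<open>\<delta>\<close> and F1'(1) =
  \<open>f2 / 2\<close>.\<close>

lemma mean_from_derivs:
  fixes \<delta> Y1 S1 Y2 S2 C f2 R1 \<sigma>1 :: complex
  assumes "\<delta> = S1 - Y1" "\<delta> \<noteq> 0"
    and "f2 = C ^ 2 - C - (Y2 + Y1 ^ 2 - Y1 + 2 * Y1 * (C - S1) + (S2 + (C - S1) ^ 2 - (C - S1)))"
    and "R1 * \<delta> + f2 / 2 = \<delta> * (Y1 + \<sigma>1)"
  shows "R1 = (S2 + Y2 + (S1 - Y1) * (1 + 2 * (S1 - C)) - (S1 - Y1) ^ 2) / (2 * (S1 - Y1)) + \<sigma>1"
proof -
  have R1: "R1 = Y1 + \<sigma>1 - f2 / (2 * \<delta>)" using assms(2,4) by (simp add: field_simps)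
  have "S1 = \<delta> + Y1" using assms(1) by simp
  then show ?thesis unfolding R1 assms(3) using assms(2)
    by (simp add: divide_simps) (simp add: algebra_simps power2_eq_square)
qed

text \<open>As for the mean, with \<open>f3\<close> for F'''(1), \<open>R2\<close> for the second
  factorial moment, and the second derivative of the same identity as last hypothesis.\<close>

lemma variance_from_derivs:
  fixes \<delta> Y1 S1 Y2 S2 Y3 S3 C f2 f3 R1 R2 \<sigma>1 \<sigma>2 :: complex
  assumes \<delta>: "\<delta> = S1 - Y1" "\<delta> \<noteq> 0"
    and f2: "f2 = C ^ 2 - C - (Y2 + Y1 ^ 2 - Y1 + 2 * Y1 * (C - S1) + (S2 + (C - S1) ^ 2 - (C - S1)))"
    and f3: "f3 = C ^ 3 - 3 * C ^ 2 + 2 * C -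
      (Y3 + 3 * Y1 * Y2 + Y1 ^ 3 - 3 * (Y2 + Y1 ^ 2) + 2 * Y1 + 3 * (Y2 + Y1 ^ 2 - Y1) * (C - S1)
       + 3 * Y1 * (S2 + (C - S1) ^ 2 - (C - S1))
       + (- S3 + 3 * (C - S1) * S2 + (C - S1) ^ 3 - 3 * (S2 + (C - S1) ^ 2) + 2 * (C - S1)))"
    and R1: "R1 * \<delta> + f2 / 2 = \<delta> * (Y1 + \<sigma>1)"
    and R2: "R2 * \<delta> + R1 * f2 + f3 / 3 = \<delta> * (Y2 + Y1 ^ 2 - Y1 + 2 * Y1 * \<sigma>1 + \<sigma>1 ^ 2 - \<sigma>2)"
  shows "R2 + R1 - R1 ^ 2 = 1 / (12 * (S1 - Y1) ^ 2) *
    (- 4 * (S3 - Y3) * (S1 - Y1) + 3 * (S2 + Y2) ^ 2 - (6 * (S2 - Y2) - 1) * (S1 - Y1) ^ 2 - (S1 - Y1) ^ 4)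
    - (\<sigma>2 - \<sigma>1)"
proof -
  \<comment> \<open>\<open>g\<close> and the \<open>h\<close> below are F1'/F1 and F1''/F1 at 1. In
    these terms the cofactor contributes g^2 - g - h to the variance, which is minus the sum of the
    first two logarithmic derivatives of F1.\<close>
  define g where "g = f2 / (2 * \<delta>)"
  have g: "f2 = 2 * \<delta> * g" using \<delta>(2) by (simp add: g_def)
  define h where "h = f3 / (3 * \<delta>)"
  have h: "f3 = 3 * \<delta> * h" using \<delta>(2) by (simp add: h_def)
  have "\<delta> * (R1 + g) = \<delta> * (Y1 + \<sigma>1)" using R1 by (simp add: g algebra_simps)
  then have T: "R1 = Y1 + \<sigma>1 - g" using \<delta>(2) by (simp add: eq_diff_eq)
  have "\<delta> * (R2 + 2 * R1 * g + h) = \<delta> * (Y2 + Y1 ^ 2 - Y1 + 2 * Y1 * \<sigma>1 + \<sigma>1 ^ 2 - \<sigma>2)"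
    using R2 by (simp add: g h algebra_simps)
  then have R2': "R2 = Y2 + Y1 ^ 2 - Y1 + 2 * Y1 * \<sigma>1 + \<sigma>1 ^ 2 - \<sigma>2 - 2 * R1 * g - h"
    using \<delta>(2) by (simp add: eq_diff_eq ac_simps)
  have var: "R2 + R1 - R1 ^ 2 = Y2 + g ^ 2 - g - h - (\<sigma>2 - \<sigma>1)"
    unfolding R2' T by (simp add: power2_eq_square algebra_simps)
  \<comment> \<open>With denominators cleared, a polynomial identity; the capacity \<open>C\<close>
    cancels.\<close>
  have poly: "12 * \<delta> ^ 2 * Y2 + 3 * f2 ^ 2 - 6 * \<delta> * f2 - 4 * \<delta> * f3 =
      - 4 * (S3 - Y3) * \<delta> + 3 * (S2 + Y2) ^ 2 - (6 * (S2 - Y2) - 1) * \<delta> ^ 2 - \<delta> ^ 4"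
    unfolding f2 f3 \<delta>(1) by algebra
  have "12 * \<delta> ^ 2 * (Y2 + g ^ 2 - g - h) = 12 * \<delta> ^ 2 * Y2 + 3 * f2 ^ 2 - 6 * \<delta> * f2 - 4 * \<delta> * f3"
    by (simp add: g h power2_eq_square algebra_simps)
  then have "Y2 + g ^ 2 - g - h = 1 / (12 * \<delta> ^ 2) *
      (- 4 * (S3 - Y3) * \<delta> + 3 * (S2 + Y2) ^ 2 - (6 * (S2 - Y2) - 1) * \<delta> ^ 2 - \<delta> ^ 4)"
    using \<delta>(2) unfolding poly by (simp add: field_simps)
  then show ?thesis unfolding var \<delta>(1) by simp
qed

section \<open>The generating function of the stationary queue\<close>

locale bulk_queue =
  fixes s y \<pi> :: "nat pmf" and C :: nat and r :: real
  assumes space_le: "set_pmf s \<subseteq> {..C}"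
    and C_pos: "C \<ge> 1"
    and y0: "0 < pmf y 0"
    and r: "1 < r" "summable (\<lambda>k. pmf y k * r ^ k)"
    and stationary: "\<pi> = bind_pmf \<pi> (\<lambda>q. bind_pmf s (\<lambda>u. map_pmf (\<lambda>k. q - u + k) y))"
    and moving: "\<not> (s = return_pmf 0 \<and> y = return_pmf 0)"
begin

definition F :: "complex \<Rightarrow> complex" where
  "F = char_fun C s (pmf_gf y)"

text \<open>The law of the unused places \<open>C - S\<close>: with it, \<open>z ^ C * E (1 / z ^ S)\<close> is a generating
  function and the characteristic function becomes \<open>z ^ C - E z ^ (Y + C - S)\<close>.\<close>

definition unused :: "nat pmf" where
  "unused = map_pmf (\<lambda>u. C - u) s"

text \<open>The contribution of the states \<open>q < u\<close>, where the truncated subtraction \<open>q - u\<close> differs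
  from the true one.\<close>

definition G :: "complex poly" where
  "G = (\<Sum>u\<le>C. \<Sum>q<u. smult (of_real (pmf s u * pmf \<pi> q)) (monom 1 C - monom 1 (C - u + q)))"

definition drift :: real where
  "drift = measure_pmf.expectation s real - measure_pmf.expectation y real"

lemma expectation_s: "measure_pmf.expectation s f = (\<Sum>u\<le>C. pmf s u *\<^sub>R f u)"
  for f :: "nat \<Rightarrow> 'c::{banach, second_countable_topology}"
  using space_le by (intro integral_measure_pmf) auto

lemma summable_unused: "summable (\<lambda>k. pmf unused k * x ^ k)"
proof (rule summable_finite[of "{..C}"])
  show "pmf unused k * x ^ k = 0" if "k \<notin> {..C}" for k
    using that space_le by (auto simp: unused_def pmf_eq_0_set_pmf)
qed simp

lemma pmf_gf_unused: "pmf_gf unused z = (\<Sum>u\<le>C. of_real (pmf s u) * z ^ (C - u))"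
proof -
  have "pmf_gf unused z = measure_pmf.expectation s (\<lambda>u. z ^ (C - u))"
    using summable_unused[of "norm z"] by (subst pmf_gf_sums(2)) (simp_all add: norm_power unused_def)
  then show ?thesis by (simp add: expectation_s scaleR_conv_of_real)
qed

lemma F_eq: "F z = z ^ C - pmf_gf y z * pmf_gf unused z"
  by (simp add: F_def char_fun_def pmf_gf_unused)

lemma poly_G: "poly G z = (\<Sum>u\<le>C. \<Sum>q<u. of_real (pmf s u * pmf \<pi> q) * (z ^ C - z ^ (C - u + q)))"
  by (simp add: G_def poly_sum poly_monom)

lemma degree_G: "degree G \<le> C"
  unfolding G_def
  by (intro degree_sum_le order.trans[OF degree_smult_le] degree_diff_le)
     (auto intro: order.trans[OF degree_monom_le])

text \<open>One step of the chain gives P(z) = Y(z) E z^max(0, Q - S). Multiplying by z^C keeps all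
  exponents nonnegative, and the truncation differs from z^(C - S) z^Q only on the finitely many
  pairs collected in \<open>G\<close>.\<close>

lemma F_times_pmf_gf:
  assumes z: "norm z \<le> 1"
  shows "F z * pmf_gf \<pi> z = pmf_gf y z * poly G z"
proof -
  have bd: "norm (z ^ k) \<le> 1" for k using z by (simp add: norm_power power_le_one)
  have int: "integrable (measure_pmf p) (\<lambda>x. z ^ f x)" for p and f :: "nat \<Rightarrow> nat"
    using bd by (intro measure_pmf.integrable_const_bound[where B = 1]) auto
  have "pmf_gf \<pi> z = measure_pmf.expectation \<pi> (\<lambda>k. z ^ k)"
    using z by (rule pmf_gf_eq_expectation)
  also have "\<dots> = measure_pmf.expectation (bind_pmf \<pi> (\<lambda>q. bind_pmf s (\<lambda>u. map_pmf (\<lambda>k. q - u + k) y))) (\<lambda>k. z ^ k)"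
    using stationary by simp
  also have "\<dots> = measure_pmf.expectation \<pi> (\<lambda>q. measure_pmf.expectation s (\<lambda>u. z ^ (q - u) * pmf_gf y z))"
    by (simp add: expectation_bind_pmf_bounded[OF bd] power_add pmf_gf_eq_expectation[OF z])
  also have "\<dots> = pmf_gf y z * measure_pmf.expectation \<pi> (\<lambda>q. \<Sum>u\<le>C. of_real (pmf s u) * z ^ (q - u))"
    by (simp add: expectation_s scaleR_conv_of_real sum_distrib_left mult.left_commute
        mult.commute[of _ "pmf_gf y z"] flip: integral_mult_right_zero)
  finally have "z ^ C * pmf_gf \<pi> z =
      pmf_gf y z * (z ^ C * measure_pmf.expectation \<pi> (\<lambda>q. \<Sum>u\<le>C. of_real (pmf s u) * z ^ (q - u)))"
    by (simp only: ac_simps)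
  also have "z ^ C * measure_pmf.expectation \<pi> (\<lambda>q. \<Sum>u\<le>C. of_real (pmf s u) * z ^ (q - u)) =
      (\<Sum>u\<le>C. of_real (pmf s u) * measure_pmf.expectation \<pi> (\<lambda>q. z ^ C * z ^ (q - u)))"
    using int by (simp add: sum_distrib_left mult.left_commute)
  also have "\<dots> = (\<Sum>u\<le>C. of_real (pmf s u) *
      (z ^ (C - u) * pmf_gf \<pi> z + (\<Sum>q<u. of_real (pmf \<pi> q) * (z ^ C - z ^ (C - u + q)))))"
  proof (intro sum.cong refl arg_cong2[where f = "(*)"])
    fix u assume "u \<in> {..C}"
    then have u: "u \<le> C" by simp
    let ?h = "\<lambda>q. if q < u then z ^ C - z ^ (C - u + q) else 0"
    \<comment> \<open>For \<open>q < u\<close> the truncated difference is 0, and \<open>?h\<close>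
      corrects the power; \<open>u \<le> C\<close> makes \<open>C - u\<close> a true
      difference.\<close>
    have split: "z ^ C * z ^ (q - u) = z ^ (C - u) * z ^ q + ?h q" for q
      using u by (auto simp: power_add[symmetric])
    have inth: "integrable (measure_pmf \<pi>) ?h"
    proof (rule measure_pmf.integrable_const_bound[where B = 2])
      have "norm (?h q) \<le> 2" for q
        using norm_triangle_ineq4[of "z ^ C" "z ^ (C - u + q)"] bd[of C] bd[of "C - u + q"] by auto
      then show "AE q in measure_pmf \<pi>. norm (?h q) \<le> 2" by simp
    qed simp
    have "measure_pmf.expectation \<pi> (\<lambda>q. z ^ C * z ^ (q - u)) =
        z ^ (C - u) * pmf_gf \<pi> z + measure_pmf.expectation \<pi> ?h"
      unfolding split pmf_gf_eq_expectation[OF z]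
      using int[of \<pi> "\<lambda>q. q"] inth by (subst Bochner_Integration.integral_add) auto
    also have "measure_pmf.expectation \<pi> ?h = (\<Sum>q<u. pmf \<pi> q *\<^sub>R ?h q)"
      by (rule integral_measure_pmf) (auto split: if_splits)
    also have "\<dots> = (\<Sum>q<u. of_real (pmf \<pi> q) * (z ^ C - z ^ (C - u + q)))"
      by (simp add: scaleR_conv_of_real)
    finally show "measure_pmf.expectation \<pi> (\<lambda>q. z ^ C * z ^ (q - u)) =
        z ^ (C - u) * pmf_gf \<pi> z + (\<Sum>q<u. of_real (pmf \<pi> q) * (z ^ C - z ^ (C - u + q)))" .
  qed
  also have "\<dots> = pmf_gf unused z * pmf_gf \<pi> z + poly G z"
    by (simp add: pmf_gf_unused poly_G sum_distrib_left sum_distrib_right distrib_left sum.distrib mult.assoc)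
  finally show ?thesis
    unfolding F_eq by (simp add: algebra_simps)
qed

lemma pmf_gf_holomorphic_y: "pmf_gf y holomorphic_on ball 0 r"
  by (intro pmf_gf_holomorphic summable_pmf_gf[OF r(2)]) simp

lemma pmf_gf_holomorphic_unused: "pmf_gf unused holomorphic_on ball 0 r"
  by (intro pmf_gf_holomorphic summable_pmf_gf[OF summable_unused]) auto

lemma F_holomorphic: "F holomorphic_on ball 0 r"
  unfolding F_eq[abs_def]
  by (intro holomorphic_intros pmf_gf_holomorphic_y pmf_gf_holomorphic_unused)

lemma expectation_unused: "measure_pmf.expectation unused real = C - measure_pmf.expectation s real"
proof -
  have "(\<Sum>u\<le>C. pmf s u) = 1"
    using expectation_s[of "\<lambda>_. 1::real"] by simp
  then show ?thesis
    by (simp add: unused_def expectation_s of_nat_diff right_diff_distrib sum_subtractf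
        flip: sum_distrib_right)
qed

lemma deriv_F:
  assumes "norm w < r"
  shows "deriv F w = of_nat C * w ^ (C - 1) - (deriv (pmf_gf y) w * pmf_gf unused w + pmf_gf y w * deriv (pmf_gf unused) w)"
proof -
  have "w \<in> ball 0 r" using assms by simp
  note [derivative_intros] =
    holomorphic_derivI[OF pmf_gf_holomorphic_y open_ball this]
    holomorphic_derivI[OF pmf_gf_holomorphic_unused open_ball this]
  show ?thesis
    unfolding F_eq[abs_def]
    by (rule DERIV_imp_deriv) (auto intro!: derivative_eq_intros)
qed

text \<open>On the unit circle a root of the characteristic function forces equality in
  \<open>\<bar>E w^X\<bar> \<le> 1\<close> for both the arrivals and the unused places, so that \<open>w^X\<close> is
  almost surely constant there.\<close>

lemma circle_root_deriv:
  assumes w: "norm w = 1" "F w = 0"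
  shows "norm (pmf_gf y w) = 1" "w * deriv F w = w ^ C * of_real drift"
proof -
  have prod: "pmf_gf y w * pmf_gf unused w = w ^ C" using w(2) by (simp add: F_eq)
  then have n: "norm (pmf_gf y w) * norm (pmf_gf unused w) = 1"
    using w(1) by (metis norm_mult norm_power power_one)
  have le: "norm (pmf_gf y w) \<le> 1" "norm (pmf_gf unused w) \<le> 1"
    using w(1) by (simp_all add: norm_pmf_gf_le_1)
  \<comment> \<open>Two factors of modulus at most 1 whose product has modulus 1.\<close>
  show n1: "norm (pmf_gf y w) = 1"
    using n le mult_left_le[of "norm (pmf_gf unused w)" "norm (pmf_gf y w)"] by simp
  have n2: "norm (pmf_gf unused w) = 1" using n n1 by simp
  have d1: "w * deriv (pmf_gf y) w = pmf_gf y w * of_real (measure_pmf.expectation y real)"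
    by (rule pmf_gf_norm_1_imp_deriv[OF r w(1) n1])
  have d2: "w * deriv (pmf_gf unused) w = pmf_gf unused w * of_real (measure_pmf.expectation unused real)"
    by (rule pmf_gf_norm_1_imp_deriv[OF r(1) summable_unused w(1) n2])
  have "w * deriv F w = of_nat C * w ^ C - (w * deriv (pmf_gf y) w * pmf_gf unused w + pmf_gf y w * (w * deriv (pmf_gf unused) w))"
    using w(1) r(1) C_pos by (subst deriv_F) (simp_all add: algebra_simps flip: power_Suc)
  also have "\<dots> = of_nat C * w ^ C - pmf_gf y w * pmf_gf unused w *
      of_real (measure_pmf.expectation y real + measure_pmf.expectation unused real)"
    unfolding d1 d2 by (simp add: algebra_simps)
  also have "\<dots> = w ^ C * of_real drift"
    by (simp add: prod expectation_unused drift_def algebra_simps)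
  finally show "w * deriv F w = w ^ C * of_real drift" .
qed

lemma F_1 [simp]: "F 1 = 0"
  by (simp add: F_eq)

lemma deriv_F_1: "deriv F 1 = of_real drift"
  using circle_root_deriv(2)[of 1] by simp

lemma poly_G_1 [simp]: "poly G 1 = 0"
  by (simp add: poly_G)

section \<open>Boundary behaviour at 1 and positivity of the drift\<close>

lemma pmf_gf_tendsto_left_1: "((\<lambda>x. pmf_gf p (of_real x)) \<longlongrightarrow> 1) (at_left (1 :: real))"
proof -
  have "filterlim (\<lambda>x. complex_of_real x) (at 1 within cball 0 1) (at_left (1 :: real))"
    unfolding filterlim_at
  proof
    have "((\<lambda>x::real. complex_of_real x) \<longlongrightarrow> of_real 1) (at_left 1)"
      by (intro tendsto_intros)
    then show "((\<lambda>x::real. complex_of_real x) \<longlongrightarrow> 1) (at_left 1)" by simp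
    show "\<forall>\<^sub>F x in at_left 1. complex_of_real x \<in> cball 0 1 \<and> complex_of_real x \<noteq> 1"
      using eventually_at_left_real[of 0 "1::real", simplified] by eventually_elim auto
  qed
  moreover have "(pmf_gf p \<longlongrightarrow> pmf_gf p 1) (at 1 within cball 0 1)"
    using continuous_on_pmf_gf[of p] unfolding continuous_on_def by (rule bspec) simp
  ultimately show ?thesis by (simp add: filterlim_compose[of "pmf_gf p"])
qed

text \<open>Divide F P = Y G by x - 1 and let x increase to 1. \<open>F\<close> and \<open>G\<close>
  enter through difference quotients, while \<open>P\<close> and \<open>Y\<close> enter only through
  their limit 1, so a possibly infinite P'(1) does no harm.\<close>

lemma deriv_G_eq_drift: "poly (pderiv G) 1 = of_real drift"
proof -
  have slope: "((\<lambda>x. f (of_real x) / (of_real x - 1)) \<longlongrightarrow> D) (at_left (1::real))"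
    if "(f has_field_derivative D) (at 1)" "f 1 = 0" for f :: "complex \<Rightarrow> complex" and D
  proof -
    have "((\<lambda>v. f v / (v - 1)) \<longlongrightarrow> D) (at 1)"
      using that by (simp add: has_field_derivative_iff)
    moreover have "filterlim (\<lambda>x. complex_of_real x) (at 1) (at_left (1 :: real))"
      unfolding filterlim_at
    proof
      have "((\<lambda>x::real. complex_of_real x) \<longlongrightarrow> of_real 1) (at_left 1)"
        by (intro tendsto_intros)
      then show "((\<lambda>x::real. complex_of_real x) \<longlongrightarrow> 1) (at_left 1)" by simp
      show "\<forall>\<^sub>F x in at_left 1. complex_of_real x \<in> UNIV \<and> complex_of_real x \<noteq> 1"
        using eventually_at_left_real[of 0 "1::real", simplified] by eventually_elim auto
    qed
    ultimately show ?thesis by (rule filterlim_compose)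
  qed
  have "(F has_field_derivative of_real drift) (at 1)"
    using holomorphic_derivI[OF F_holomorphic, of 1 UNIV] r(1) by (simp add: deriv_F_1)
  from tendsto_mult[OF slope[OF this F_1] pmf_gf_tendsto_left_1[of \<pi>]]
  have "((\<lambda>x. F (of_real x) / (of_real x - 1) * pmf_gf \<pi> (of_real x)) \<longlongrightarrow> of_real drift) (at_left (1::real))"
    by simp
  moreover have "\<forall>\<^sub>F x in at_left (1::real). F (of_real x) / (of_real x - 1) * pmf_gf \<pi> (of_real x) =
      pmf_gf y (of_real x) * (poly G (of_real x) / (of_real x - 1))"
    using eventually_at_left_real[of 0 "1::real", simplified]
  proof eventually_elim
    case (elim x)
    then show ?case using F_times_pmf_gf[of "of_real x"] by simp
  qed
  ultimately have lim1: "((\<lambda>x. pmf_gf y (of_real x) * (poly G (of_real x) / (of_real x - 1))) \<longlongrightarrow> of_real drift) (at_left (1::real))"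
    by (rule Lim_transform_eventually)
  have lim2: "((\<lambda>x. pmf_gf y (of_real x) * (poly G (of_real x) / (of_real x - 1))) \<longlongrightarrow> 1 * poly (pderiv G) 1) (at_left (1::real))"
    by (intro tendsto_mult pmf_gf_tendsto_left_1 slope poly_DERIV poly_G_1)
  show ?thesis
    using tendsto_unique[OF trivial_limit_at_left_real lim2 lim1] by simp
qed

lemma drift_eq: "drift = (\<Sum>u\<le>C. \<Sum>q<u. pmf s u * pmf \<pi> q * (real u - real q))"
proof -
  have "poly (pderiv G) 1 = (\<Sum>u\<le>C. \<Sum>q<u. of_real (pmf s u * pmf \<pi> q) * (of_nat C - of_nat (C - u + q)))"
    by (simp add: G_def pderiv_sum pderiv_smult pderiv_diff pderiv_monom poly_sum poly_monom)
  also have "\<dots> = of_real (\<Sum>u\<le>C. \<Sum>q<u. pmf s u * pmf \<pi> q * (real u - real q))"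
    by (simp add: of_nat_diff)
  finally have "complex_of_real drift = of_real (\<Sum>u\<le>C. \<Sum>q<u. pmf s u * pmf \<pi> q * (real u - real q))"
    using deriv_G_eq_drift by simp
  then show ?thesis by (simp only: of_real_eq_iff)
qed

lemma F_nonzero_on_interval:
  assumes "\<And>x. 0 < x \<Longrightarrow> x < 1 \<Longrightarrow> F (of_real x) = 0"
  shows False
proof -
  have root: "x ^ C = Re (pmf_gf y (of_real x)) * Re (pmf_gf unused (of_real x))" if "0 < x" "x < 1" for x
  proof -
    have "of_real (x ^ C) = pmf_gf y (of_real x) * pmf_gf unused (of_real x)"
      using assms[OF that] by (simp add: F_eq)
    also have "\<dots> = of_real (Re (pmf_gf y (of_real x)) * Re (pmf_gf unused (of_real x)))"
      using pmf_gf_of_real(2)[of x y] pmf_gf_of_real(2)[of x unused] that by simp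
    finally show ?thesis by (simp only: of_real_eq_iff)
  qed
  have s0: "pmf s u = 0" if u: "u \<noteq> 0" for u
  proof (rule ccontr)
    assume "pmf s u \<noteq> 0"
    then have "u \<in> set_pmf s" by (simp add: set_pmf_iff)
    then have pos: "0 < pmf s u" and uC: "u \<le> C"
      using space_le by (auto simp: pmf_positive)
    have "pmf s u \<le> pmf unused (C - u)"
      unfolding unused_def pmf_map by (subst pmf.rep_eq, intro measure_pmf.finite_measure_mono) auto
    \<comment> \<open>Half of the left side of the bound: then
      \<open>2 * x \<le> x ^ u \<le> x\<close>, which is absurd for positive
      \<open>x\<close>.\<close>
    define x where "x = pmf y 0 * pmf s u / 2"
    have x: "0 < x" "x < 1"
      using y0 pos mult_le_one[of "pmf y 0" "pmf s u"] by (auto simp: x_def pmf_le_1)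
    have "pmf y 0 * (pmf s u * x ^ (C - u)) \<le> Re (pmf_gf y (of_real x)) * Re (pmf_gf unused (of_real x))"
    proof (rule mult_mono)
      show "pmf y 0 \<le> Re (pmf_gf y (of_real x))"
        using pmf_le_pmf_gf[of x y 0] x by simp
      have "pmf s u * x ^ (C - u) \<le> pmf unused (C - u) * x ^ (C - u)"
        using \<open>pmf s u \<le> _\<close> x by (intro mult_right_mono) auto
      also have "\<dots> \<le> Re (pmf_gf unused (of_real x))"
        using pmf_le_pmf_gf[of x unused "C - u"] x by simp
      finally show "pmf s u * x ^ (C - u) \<le> Re (pmf_gf unused (of_real x))" .
      show "0 \<le> Re (pmf_gf y (of_real x))" using pmf_gf_pos[of x y] x by simp
      show "0 \<le> pmf s u * x ^ (C - u)" using x by simp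
    qed
    also have "\<dots> = x ^ u * x ^ (C - u)"
      using root[OF x] uC by (simp flip: power_add)
    finally have "pmf y 0 * pmf s u * x ^ (C - u) \<le> x ^ u * x ^ (C - u)" by (simp add: mult.assoc)
    then have "pmf y 0 * pmf s u \<le> x ^ u"
      using x by (simp add: mult_le_cancel_right)
    also have "\<dots> \<le> x" using x u power_decreasing[of 1 u x] by simp
    finally have "2 * x \<le> x" by (simp add: x_def)
    then show False using x by simp
  qed
  have "set_pmf s \<subseteq> {0}" using s0 by (force simp: set_pmf_iff)
  then have s: "s = return_pmf 0" by (simp add: set_pmf_subset_singleton)
  have "unused = return_pmf C"
    by (rule unused_def[THEN trans]) (simp add: s)
  then have "pmf_gf unused (of_real (1 / 2)) = of_real (1 / 2) ^ C"
    by (simp add: pmf_gf_eq_expectation)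
  then have "Re (pmf_gf y (of_real (1 / 2))) = 1"
    using root[of "1 / 2"] by (simp flip: of_real_power)
  then have "(\<lambda>k. pmf y k * (1 / 2) ^ k) sums 1"
    using pmf_gf_of_real(1)[of "1 / 2" y] by simp
  \<comment> \<open>Subtracting the series at 1/2 from the one at 1 leaves nonnegative terms with
    sum 0, so every mass with \<open>k > 0\<close> vanishes.\<close>
  from sums_diff[OF pmf_nat_sums_1[of y] this]
  have z: "(\<lambda>k. pmf y k * (1 - (1 / 2) ^ k)) sums 0" by (simp add: algebra_simps)
  have "pmf y k * (1 - (1 / 2) ^ k) = 0" for k
    using z suminf_eq_zero_iff[OF sums_summable[OF z]] by (simp add: sums_iff power_le_one)
  then have "pmf y k = 0" if "k \<noteq> 0" for k
    using that power_strict_decreasing[of 0 k "1 / 2 :: real"] by fastforce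
  then have "set_pmf y \<subseteq> {0}" by (force simp: set_pmf_iff)
  then have "y = return_pmf 0" by (simp add: set_pmf_subset_singleton)
  with s moving show False by simp
qed

text \<open>All terms of \<open>drift_eq\<close> are nonnegative. If they sum to 0, every
  coefficient of \<open>G\<close> carries weight 0, hence F P = 0; since \<open>P\<close> is
  positive on (0,1), \<open>F\<close> would vanish there.\<close>

lemma drift_pos: "0 < drift"
proof -
  have nn: "0 \<le> pmf s u * pmf \<pi> q * (real u - real q)" if "q \<in> {..<u}" for u q
    using that by simp
  have "0 \<le> drift" unfolding drift_eq by (intro sum_nonneg nn)
  moreover have "drift \<noteq> 0"
  proof
    assume "drift = 0"
    then have "\<forall>u\<in>{..C}. (\<Sum>q<u. pmf s u * pmf \<pi> q * (real u - real q)) = 0"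
      unfolding drift_eq by (subst (asm) sum_nonneg_eq_0_iff) (auto intro!: sum_nonneg nn)
    then have "\<forall>u\<in>{..C}. \<forall>q\<in>{..<u}. pmf s u * pmf \<pi> q * (real u - real q) = 0"
      by (subst (asm) sum_nonneg_eq_0_iff) (auto intro!: nn)
    then have "pmf s u * pmf \<pi> q = 0" if "u \<in> {..C}" "q \<in> {..<u}" for u q using that by auto
    then have "poly G v = 0" for v unfolding poly_G by (intro sum.neutral ballI) (simp del: of_real_mult)
    then have "F v * pmf_gf \<pi> v = 0" if "norm v \<le> 1" for v
      using F_times_pmf_gf[OF that] by simp
    moreover have "pmf_gf \<pi> (of_real x) \<noteq> 0" if "0 < x" "x < 1" for x
      using pmf_gf_pos[of x \<pi>] that by force
    ultimately show False
      by (intro F_nonzero_on_interval) (metis abs_of_pos less_imp_le mult_eq_0_iff norm_of_real)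
  qed
  ultimately show ?thesis by simp
qed

lemma G_nonzero: "G \<noteq> 0"
  using deriv_G_eq_drift drift_pos by auto

lemma F_not_identically_zero: "\<exists>w\<in>ball 0 1. F w \<noteq> 0"
proof (rule ccontr)
  assume "\<not> (\<exists>w\<in>ball 0 1. F w \<noteq> 0)"
  then show False by (intro F_nonzero_on_interval) auto
qed

section \<open>Zeros of \<open>F\<close> and the factorization of \<open>G\<close>\<close>

lemma zorder_F_circle:
  assumes w: "norm w = 1" "F w = 0"
  shows "zorder F w = 1"
proof -
  have "w \<noteq> 0" using w by auto
  then have "deriv F w \<noteq> 0"
    using circle_root_deriv(2)[OF w] drift_pos by auto
  then show ?thesis
    using w r(1) by (intro zorder_zero_eqI[OF F_holomorphic open_ball]) auto
qed

text \<open>On the circle the zero is simple, so G(w) = 0 suffices, and it follows from |Y(w)| = 1.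
  Inside the disk, where \<open>P\<close> is holomorphic, the local factorization of
  \<open>F\<close> is carried over to \<open>G\<close>.\<close>

lemma G_divisible:
  assumes w: "norm w \<le> 1" "F w = 0"
  shows "[:-w, 1:] ^ nat (zorder F w) dvd G"
proof (cases "norm w = 1")
  case True
  have "pmf_gf y w \<noteq> 0" using circle_root_deriv(1)[OF True w(2)] by auto
  then have "poly G w = 0" using F_times_pmf_gf[OF w(1)] w(2) by simp
  then show ?thesis by (simp add: zorder_F_circle[OF True w(2)] poly_eq_0_iff_dvd)
next
  case False
  then have w1: "w \<in> ball 0 1" using w(1) by simp
  have "F holomorphic_on ball 0 1"
    using r(1) by (intro holomorphic_on_subset[OF F_holomorphic]) auto
  then obtain \<rho> where \<rho>: "\<rho> > 0" "cball w \<rho> \<subseteq> ball 0 1" "zor_poly F w holomorphic_on cball w \<rho>"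
    "\<And>v. v \<in> cball w \<rho> \<Longrightarrow> F v = zor_poly F w v * (v - w) ^ nat (zorder F w)"
    using zorder_factorization[OF _ open_ball connected_ball w1 F_not_identically_zero] by metis
  have y: "pmf_gf y holomorphic_on ball 0 1" "pmf_gf \<pi> holomorphic_on ball 0 1"
    by (auto intro!: pmf_gf_holomorphic summable_pmf_disk)
  show ?thesis
  proof (rule root_power_dvd_poly)
    have "isCont (zor_poly F w) w"
      using holomorphic_on_imp_continuous_on[OF \<rho>(3)] \<rho>(1)
      by (intro continuous_on_interior[where S = "cball w \<rho>"]) auto
    moreover have "isCont (pmf_gf \<pi>) w"
      using holomorphic_on_imp_continuous_on[OF y(2)] w1 by (simp add: continuous_on_eq_continuous_at)
    ultimately show "isCont (\<lambda>v. zor_poly F w v * pmf_gf \<pi> v) w" by (intro continuous_intros)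
    show "isCont (pmf_gf y) w"
      using holomorphic_on_imp_continuous_on[OF y(1)] w1 by (simp add: continuous_on_eq_continuous_at)
    show "pmf_gf y w \<noteq> 0"
    proof
      \<comment> \<open>A common zero of \<open>F\<close> and Y has w^C = 0, so it would be 0, where
        Y equals \<open>pmf y 0 > 0\<close>.\<close>
      assume 0: "pmf_gf y w = 0"
      then have "w = 0" using w(2) by (simp add: F_eq)
      then show False using 0 y0 by (simp add: pmf_gf_0)
    qed
    have "\<forall>\<^sub>F v in at w. v \<in> ball w \<rho>"
      using \<rho>(1) by (intro eventually_at_in_open') auto
    then show "\<forall>\<^sub>F v in at w. zor_poly F w v * pmf_gf \<pi> v * (v - w) ^ nat (zorder F w) = pmf_gf y v * poly G v"
    proof eventually_elim
      case (elim v)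
      then have v: "v \<in> cball w \<rho>" "norm v \<le> 1" using subsetD[OF \<rho>(2), of v] by auto
      show ?case using F_times_pmf_gf[OF v(2)] \<rho>(4)[OF v(1)] by (simp add: ac_simps)
    qed
  qed
qed

lemma root_count_1:
  assumes z: "lists_disk_roots F C z"
  shows "card {i. i < C \<and> z i = 1} = 1"
proof -
  have "int (card {i. i < C \<and> z i = 1}) = zorder F 1"
    using z unfolding lists_disk_roots_def by auto
  then show ?thesis using zorder_F_circle[of 1] by simp
qed

lemma other_roots_ne_1:
  assumes z: "lists_disk_roots F C z" "z 0 = 1" and i: "0 < i" "i < C"
  shows "z i \<noteq> 1"
proof
  assume "z i = 1"
  then have "{0, i} \<subseteq> {i. i < C \<and> z i = 1}" using i z(2) by auto
  from card_mono[OF _ this] have "2 \<le> card {i. i < C \<and> z i = 1}" using i by simp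
  then show False using root_count_1[OF z(1)] by simp
qed

lemma G_factorization:
  assumes z: "lists_disk_roots F C z" "z 0 = 1"
  obtains c where "c \<noteq> 0" "\<And>v. poly G v = c * (v - 1) * (\<Prod>i = 1..C - 1. (v - z i))"
proof -
  have "(\<Prod>i<C. [:-z i, 1:]) dvd G"
  proof (rule prod_roots_dvd[OF G_nonzero])
    fix w assume "w \<in> z ` {..<C}"
    then have w: "norm w \<le> 1" "F w = 0" using z(1) by (auto simp: lists_disk_roots_def)
    then have "card {i. i < C \<and> z i = w} = nat (zorder F w)"
      using z(1) unfolding lists_disk_roots_def by (metis nat_int)
    then show "[:-w, 1:] ^ card {i. i < C \<and> z i = w} dvd G" using G_divisible[OF w] by simp
  qed
  then obtain q where q: "G = (\<Prod>i<C. [:-z i, 1:]) * q" by (rule dvdE)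
  have "q \<noteq> 0" using q G_nonzero by auto
  moreover have "(\<Prod>i<C. [:-z i, 1:]) \<noteq> 0" by simp
  moreover have "degree (\<Prod>i<C. [:-z i, 1:]) = C"
    by (subst degree_prod_eq_sum_degree) auto
  \<comment> \<open>The \<open>C\<close> linear factors already exhaust the degree bound of
    \<open>G\<close>, so the quotient is constant.\<close>
  ultimately have "degree q = 0" using q degree_G by (simp add: degree_mult_eq)
  then obtain c where c: "q = [:c:]" by (rule degree_eq_zeroE)
  have "{..<C} = insert 0 {1..C - 1}" using C_pos by auto
  then have "poly G v = c * (v - 1) * (\<Prod>i = 1..C - 1. (v - z i))" for v
    by (simp add: q c poly_prod z(2) algebra_simps)
  moreover have "c \<noteq> 0" using c \<open>q \<noteq> 0\<close> by simp
  ultimately show ?thesis using that by blast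
qed

text \<open>Near \<open>1\<close> the generating function of the queue agrees inside the disk with the function
  \<open>R\<close>, which is holomorphic around \<open>1\<close>; the moments of the queue are read off from \<open>R\<close>.\<close>

lemma queue_gf_continuation:
  assumes z: "lists_disk_roots F C z" "z 0 = 1"
  obtains \<rho> R F1 c where "0 < \<rho>" "ball (1::complex) \<rho> \<subseteq> ball 0 r"
    "R holomorphic_on ball 1 \<rho>" "F1 holomorphic_on ball 1 \<rho>"
    "\<And>v. v \<in> ball 1 \<rho> \<Longrightarrow> F v = F1 v * (v - 1)"
    "\<And>v. v \<in> ball 1 \<rho> \<Longrightarrow> R v * F1 v = pmf_gf y v * (c * (\<Prod>i = 1..C - 1. (v - z i)))"
    "\<And>v. v \<in> ball 1 \<rho> \<Longrightarrow> norm v < 1 \<Longrightarrow> pmf_gf \<pi> v = R v"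
proof -
  obtain c where c: "c \<noteq> 0" "\<And>v. poly G v = c * (v - 1) * (\<Prod>i = 1..C - 1. (v - z i))"
    using G_factorization[OF z] by blast
  have ex: "\<exists>w\<in>ball 0 r. F w \<noteq> 0" using F_not_identically_zero r(1) by force
  have one: "1 \<in> ball (0::complex) r" using r(1) by simp
  obtain \<rho> where \<rho>: "\<rho> > 0" "cball (1::complex) \<rho> \<subseteq> ball 0 r" "zor_poly F 1 holomorphic_on cball 1 \<rho>"
    "\<And>v. v \<in> cball 1 \<rho> \<Longrightarrow> F v = zor_poly F 1 v * (v - 1) ^ nat (zorder F 1)"
    "\<And>v. v \<in> cball 1 \<rho> \<Longrightarrow> zor_poly F 1 v \<noteq> 0"
    by (rule zorder_factorization[OF F_holomorphic open_ball connected_ball one ex]) (rule that)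
  have zo: "nat (zorder F 1) = 1" using zorder_F_circle[of 1] by simp
  \<comment> \<open>This is Y G / F with the common simple factor \<open>v - 1\<close> cancelled;
    the remaining denominator has no zero near 1.\<close>
  define R where "R v = pmf_gf y v * (c * (\<Prod>i = 1..C - 1. (v - z i))) / zor_poly F 1 v" for v
  have sub: "ball (1::complex) \<rho> \<subseteq> cball 1 \<rho>" by (rule ball_subset_cball)
  have F1: "zor_poly F 1 holomorphic_on ball 1 \<rho>" using \<rho>(3) sub by (rule holomorphic_on_subset)
  have y: "pmf_gf y holomorphic_on ball 1 \<rho>"
    using pmf_gf_holomorphic_y \<rho>(2) sub by (blast intro: holomorphic_on_subset)
  show ?thesis
  proof (rule that[of \<rho> R "zor_poly F 1" c])
    show "R holomorphic_on ball 1 \<rho>"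
      unfolding R_def using \<rho>(5) sub by (intro holomorphic_intros y F1) auto
    show "pmf_gf \<pi> v = R v" if v: "v \<in> ball 1 \<rho>" "norm v < 1" for v
    proof -
      have v': "v - 1 \<noteq> 0" "zor_poly F 1 v \<noteq> 0" using v \<rho>(5) sub by auto
      have "zor_poly F 1 v * (v - 1) * pmf_gf \<pi> v = pmf_gf y v * (c * (v - 1) * (\<Prod>i = 1..C - 1. (v - z i)))"
        using F_times_pmf_gf[of v] v \<rho>(4)[of v] sub by (auto simp: zo c(2))
      then have "(v - 1) * (zor_poly F 1 v * pmf_gf \<pi> v) = (v - 1) * (pmf_gf y v * (c * (\<Prod>i = 1..C - 1. (v - z i))))"
        by (simp only: ac_simps)
      then have "zor_poly F 1 v * pmf_gf \<pi> v = pmf_gf y v * (c * (\<Prod>i = 1..C - 1. (v - z i)))"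
        using v'(1) by simp
      then show ?thesis using v'(2) by (simp add: R_def field_simps)
    qed
    show "0 < \<rho>" by (rule \<rho>(1))
    show "ball (1::complex) \<rho> \<subseteq> ball 0 r" using sub \<rho>(2) by (rule order.trans)
    show "zor_poly F 1 holomorphic_on ball 1 \<rho>" by (rule F1)
    show "F v = zor_poly F 1 v * (v - 1)" if "v \<in> ball 1 \<rho>" for v
      using \<rho>(4)[of v] that sub by (auto simp: zo)
    \<comment> \<open>The relation is exported in multiplied form, ready for the Leibniz
      rule.\<close>
    show "R v * zor_poly F 1 v = pmf_gf y v * (c * (\<Prod>i = 1..C - 1. (v - z i)))"
      if "v \<in> ball 1 \<rho>" for v
      using \<rho>(5)[of v] that sub by (auto simp: R_def)
  qed
qed

text \<open>Derivatives of \<open>R\<close> are continuous at 1 and agree with those of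
  \<open>P\<close> just to the left, so the left limit exists and is finite; nonnegative
  coefficients then force the moment series itself to converge to it.\<close>

lemma factorial_moment_continuation:
  assumes "0 < \<rho>" "R holomorphic_on ball 1 \<rho>"
    and eq: "\<And>v. v \<in> ball 1 \<rho> \<Longrightarrow> norm v < 1 \<Longrightarrow> pmf_gf \<pi> v = R v"
  shows "integrable (measure_pmf \<pi>) (\<lambda>q. fact n * real (q choose n))"
    and "(deriv ^^ n) R 1 = of_real (measure_pmf.expectation \<pi> (\<lambda>q. fact n * real (q choose n)))"
proof -
  define a where "a = (diffs ^^ n) (pmf \<pi>)"
  have a0: "0 \<le> a k" for k by (simp add: a_def diffs_funpow)
  have ca: "(diffs ^^ n) (\<lambda>k. complex_of_real (pmf \<pi> k)) = (\<lambda>k. of_real (a k))"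
    by (simp add: a_def diffs_funpow_of_real fun_eq_iff)
  have hol: "pmf_gf \<pi> holomorphic_on ball 0 1"
    by (intro pmf_gf_holomorphic summable_pmf_disk) simp
  have sum: "summable (\<lambda>k. a k * x ^ k)"
    and val: "(deriv ^^ n) (pmf_gf \<pi>) (of_real x) = of_real (\<Sum>k. a k * x ^ k)"
    if "0 \<le> x" "x < 1" for x
  proof -
    have "summable (\<lambda>k. of_real (a k) * complex_of_real x ^ k)"
      using pmf_gf_higher_deriv(1)[of 1 \<pi> "of_real x" n, OF summable_pmf_disk] that by (simp add: ca)
    then have "summable (\<lambda>k. complex_of_real (a k * x ^ k))" by simp
    then show s: "summable (\<lambda>k. a k * x ^ k)" by (simp only: summable_complex_of_real)
    have "(deriv ^^ n) (pmf_gf \<pi>) (of_real x) = (\<Sum>k. of_real (a k) * complex_of_real x ^ k)"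
      using pmf_gf_higher_deriv(2)[of 1 \<pi> "of_real x" n, OF summable_pmf_disk] that by (simp add: ca)
    also have "\<dots> = of_real (\<Sum>k. a k * x ^ k)"
      using suminf_of_real[OF s, where 'a = complex] by simp
    finally show "(deriv ^^ n) (pmf_gf \<pi>) (of_real x) = of_real (\<Sum>k. a k * x ^ k)" .
  qed
  have "isCont ((deriv ^^ n) R) 1"
    using holomorphic_on_imp_continuous_on[OF holomorphic_higher_deriv[OF assms(2) open_ball]] assms(1)
    by (simp add: continuous_on_eq_continuous_at)
  from tendsto_at_left_1_complex[OF this]
  have lim: "((\<lambda>x. (deriv ^^ n) R (of_real x)) \<longlongrightarrow> (deriv ^^ n) R 1) (at_left (1::real))" .
  have "\<forall>\<^sub>F x in at_left (1::real). (deriv ^^ n) R (of_real x) = of_real (\<Sum>k. a k * x ^ k)"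
  proof (rule eventually_mono)
    \<comment> \<open>The lower end keeps \<open>x\<close> both nonnegative, for the power series,
      and within \<open>\<rho>\<close> of 1, for the continuation.\<close>
    show "\<forall>\<^sub>F x in at_left 1. x \<in> {max 0 (1 - \<rho>)<..<1}"
      using assms(1) by (intro eventually_at_left_real) simp
    fix x assume x: "x \<in> {max 0 (1 - \<rho>)<..<1}"
    have "norm (1 - complex_of_real x) = norm (complex_of_real (1 - x))" by simp
    also have "\<dots> = 1 - x" using x by (simp only: norm_of_real) simp
    finally have xin: "complex_of_real x \<in> ball 1 \<rho> \<inter> ball 0 1" using x by (auto simp: dist_norm)
    have "(deriv ^^ n) (pmf_gf \<pi>) (of_real x) = (deriv ^^ n) R (of_real x)"
    proof (rule higher_deriv_transform_within_open)
      show "pmf_gf \<pi> holomorphic_on ball 1 \<rho> \<inter> ball 0 1"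
        using hol by (rule holomorphic_on_subset) auto
      show "R holomorphic_on ball 1 \<rho> \<inter> ball 0 1"
        using assms(2) by (rule holomorphic_on_subset) auto
      show "open (ball 1 \<rho> \<inter> ball (0::complex) 1)" by auto
    qed (use xin eq in auto)
    then show "(deriv ^^ n) R (of_real x) = of_real (\<Sum>k. a k * x ^ k)"
      using val[of x] x by simp
  qed
  from Lim_transform_eventually[OF lim this]
  have lim2: "((\<lambda>x. complex_of_real (\<Sum>k. a k * x ^ k)) \<longlongrightarrow> (deriv ^^ n) R 1) (at_left (1::real))" .
  from tendsto_Re[OF lim2] have "((\<lambda>x. \<Sum>k. a k * x ^ k) \<longlongrightarrow> Re ((deriv ^^ n) R 1)) (at_left 1)"
    by (simp only: Re_complex_of_real)
  from nonneg_powser_sums_left_limit[OF a0 sum this]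
  have "(\<lambda>k. (diffs ^^ n) (pmf \<pi>) k) sums Re ((deriv ^^ n) R 1)" by (simp add: a_def)
  note fm = factorial_moment[OF this]
  show "integrable (measure_pmf \<pi>) (\<lambda>q. fact n * real (q choose n))" by (rule fm)
  \<comment> \<open>A limit of real values is real.\<close>
  have "Im ((deriv ^^ n) R 1) = 0"
    using tendsto_unique[OF trivial_limit_at_left_real tendsto_Im[OF lim2]] by (simp add: tendsto_const)
  then show "(deriv ^^ n) R 1 = of_real (measure_pmf.expectation \<pi> (\<lambda>q. fact n * real (q choose n)))"
    using fm(2) by (simp only: complex_eq_iff Re_complex_of_real Im_complex_of_real)
qed

section \<open>Derivatives at 1 and the moment formulas\<close>

text \<open>The reflection \<open>C - S\<close> keeps the second central moment and reverses the
  sign of the third, whence the opposite signs of \<open>S3\<close> and \<open>Y3\<close> in the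
  variance.\<close>

lemma unused_moments:
  fixes mu defines "mu \<equiv> measure_pmf.expectation s real"
  shows "measure_pmf.expectation unused (\<lambda>k. (real k - measure_pmf.expectation unused real) ^ 2) =
      measure_pmf.expectation s (\<lambda>k. (real k - mu) ^ 2)"
    and "measure_pmf.expectation unused (\<lambda>k. (real k - measure_pmf.expectation unused real) ^ 3) =
      - measure_pmf.expectation s (\<lambda>k. (real k - mu) ^ 3)"
proof -
  have diff: "real (C - u) - (real C - mu) = - (real u - mu)" if "u \<le> C" for u
    using that by (simp add: of_nat_diff)
  have cube: "(- a) ^ 3 = - (a ^ 3)" for a :: real by simp
  show "measure_pmf.expectation unused (\<lambda>k. (real k - measure_pmf.expectation unused real) ^ 2) =
      measure_pmf.expectation s (\<lambda>k. (real k - mu) ^ 2)"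
    unfolding expectation_unused mu_def[symmetric] unfolding unused_def integral_map_pmf expectation_s
    by (intro sum.cong refl) (simp only: diff power2_minus atMost_iff)
  show "measure_pmf.expectation unused (\<lambda>k. (real k - measure_pmf.expectation unused real) ^ 3) =
      - measure_pmf.expectation s (\<lambda>k. (real k - mu) ^ 3)"
    unfolding expectation_unused mu_def[symmetric] unfolding unused_def integral_map_pmf expectation_s
      sum_negf[symmetric]
    by (intro sum.cong refl) (simp only: diff cube atMost_iff scaleR_minus_right)
qed

lemma F_derivs_at_1:
  fixes S1 S2 S3 Y1 Y2 Y3 :: real
  defines "S1 \<equiv> measure_pmf.expectation s real"
    and "S2 \<equiv> measure_pmf.expectation s (\<lambda>k. (real k - S1) ^ 2)"
    and "S3 \<equiv> measure_pmf.expectation s (\<lambda>k. (real k - S1) ^ 3)"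
    and "Y1 \<equiv> measure_pmf.expectation y real"
    and "Y2 \<equiv> measure_pmf.expectation y (\<lambda>k. (real k - Y1) ^ 2)"
    and "Y3 \<equiv> measure_pmf.expectation y (\<lambda>k. (real k - Y1) ^ 3)"
  defines "d \<equiv> real C - S1"
  shows "(deriv ^^ 2) F 1 = of_real (real C ^ 2 - real C - (Y2 + Y1 ^ 2 - Y1 + 2 * Y1 * d + (S2 + d ^ 2 - d)))"
    and "(deriv ^^ 3) F 1 = of_real (real C ^ 3 - 3 * real C ^ 2 + 2 * real C -
      (Y3 + 3 * Y1 * Y2 + Y1 ^ 3 - 3 * (Y2 + Y1 ^ 2) + 2 * Y1 + 3 * (Y2 + Y1 ^ 2 - Y1) * d
       + 3 * Y1 * (S2 + d ^ 2 - d) + (- S3 + 3 * d * S2 + d ^ 3 - 3 * (S2 + d ^ 2) + 2 * d)))"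
proof -
  \<comment> \<open>Any radius beyond 1 would do for this single-term series.\<close>
  have ret: "summable (\<lambda>k. pmf (return_pmf C) k * 2 ^ k)"
    by (rule summable_finite[of "{C}"]) auto
  have pow: "pmf_gf (return_pmf C) = (\<lambda>v. v ^ C)"
  proof
    fix v :: complex
    have "summable (\<lambda>k. pmf (return_pmf C) k * norm (v ^ k))"
      by (rule summable_finite[of "{C}"]) auto
    from pmf_gf_sums(2)[OF this] show "pmf_gf (return_pmf C) v = v ^ C" by simp
  qed
  note dp = pmf_gf_derivs_at_1[OF _ ret, unfolded pow, simplified]
  note du = pmf_gf_derivs_at_1[OF r(1) summable_unused, unfolded unused_moments, unfolded expectation_unused,
      folded S1_def, folded S2_def S3_def d_def]
  note dy = pmf_gf_derivs_at_1[OF r, folded Y1_def, folded Y2_def Y3_def]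
  have one: "1 \<in> ball (0::complex) r" using r(1) by simp
  have hp: "(\<lambda>v. v ^ C) holomorphic_on ball 0 r" by (intro holomorphic_intros)
  have hm: "(\<lambda>v. pmf_gf y v * pmf_gf unused v) holomorphic_on ball 0 r"
    by (intro holomorphic_intros pmf_gf_holomorphic_y pmf_gf_holomorphic_unused)
  have "(deriv ^^ n) F 1 = (deriv ^^ n) (\<lambda>v. v ^ C) 1 -
      (\<Sum>i = 0..n. of_nat (n choose i) * (deriv ^^ i) (pmf_gf y) 1 * (deriv ^^ (n - i)) (pmf_gf unused) 1)" for n
    unfolding F_eq[abs_def] higher_deriv_diff[OF hp hm open_ball one]
      higher_deriv_mult[OF pmf_gf_holomorphic_y pmf_gf_holomorphic_unused open_ball one] ..
  note D = this
  have c3: "3 choose Suc 0 = 3" "3 choose 2 = 3" by (simp_all add: numeral_eq_Suc)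
  show "(deriv ^^ 2) F 1 = of_real (real C ^ 2 - real C - (Y2 + Y1 ^ 2 - Y1 + 2 * Y1 * d + (S2 + d ^ 2 - d)))"
    using D[of 2] dp(2) du(1,2) dy(1,2) by (simp add: numeral_2_eq_2)
  have "{0..3} = {0, 1, 2, 3 :: nat}" by auto
  then show "(deriv ^^ 3) F 1 = of_real (real C ^ 3 - 3 * real C ^ 2 + 2 * real C -
      (Y3 + 3 * Y1 * Y2 + Y1 ^ 3 - 3 * (Y2 + Y1 ^ 2) + 2 * Y1 + 3 * (Y2 + Y1 ^ 2 - Y1) * d
       + 3 * Y1 * (S2 + d ^ 2 - d) + (- S3 + 3 * d * S2 + d ^ 3 - 3 * (S2 + d ^ 2) + 2 * d)))"
    using D[of 3] dp(3) du dy by (simp add: c3 numeral_2_eq_2[symmetric])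
qed

text \<open>The identity between \<open>R\<close>, the cofactor \<open>F1\<close> and the product
  over the roots is read at 1 in orders 0, 1 and 2: order 0 fixes the constant, order 1 gives the
  mean, order 2 the second factorial moment.\<close>

lemma queue_moments:
  fixes S1 S2 S3 Y1 Y2 Y3 :: real
  assumes z: "lists_disk_roots F C z" "z 0 = 1"
  defines "S1 \<equiv> measure_pmf.expectation s real"
    and "S2 \<equiv> measure_pmf.expectation s (\<lambda>k. (real k - S1) ^ 2)"
    and "S3 \<equiv> measure_pmf.expectation s (\<lambda>k. (real k - S1) ^ 3)"
    and "Y1 \<equiv> measure_pmf.expectation y real"
    and "Y2 \<equiv> measure_pmf.expectation y (\<lambda>k. (real k - Y1) ^ 2)"
    and "Y3 \<equiv> measure_pmf.expectation y (\<lambda>k. (real k - Y1) ^ 3)"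
  shows "integrable (measure_pmf \<pi>) real"
    and "integrable (measure_pmf \<pi>) (\<lambda>q. (real q)\<^sup>2)"
    and "complex_of_real (measure_pmf.expectation \<pi> real) =
      complex_of_real ((S2 + Y2 + (S1 - Y1) * (1 + 2 * (S1 - real C)) - (S1 - Y1)\<^sup>2) / (2 * (S1 - Y1)))
      + (\<Sum>i = 1..C - 1. 1 / (1 - z i))"
    and "complex_of_real (measure_pmf.variance \<pi> real) =
      complex_of_real (1 / (12 * (S1 - Y1)\<^sup>2) *
        (- 4 * (S3 - Y3) * (S1 - Y1) + 3 * (S2 + Y2)\<^sup>2
         - (6 * (S2 - Y2) - 1) * (S1 - Y1)\<^sup>2 - (S1 - Y1) ^ 4))
      - (\<Sum>i = 1..C - 1. z i / (1 - z i)\<^sup>2)"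
proof -
  define p where "p v = (\<Prod>i = 1..C - 1. (v - z i))" for v
  define \<sigma>1 where "\<sigma>1 = (\<Sum>i = 1..C - 1. 1 / (1 - z i))"
  define \<sigma>2 where "\<sigma>2 = (\<Sum>i = 1..C - 1. 1 / (1 - z i)\<^sup>2)"
  have ne: "z i \<noteq> 1" if "i \<in> {1..C - 1}" for i
  proof -
    have "0 < i" "i < C" using that by auto
    then show ?thesis by (rule other_roots_ne_1[OF z])
  qed
  obtain \<rho> R F1 c where \<rho>: "0 < \<rho>" and sub: "ball (1::complex) \<rho> \<subseteq> ball 0 r"
    and R: "R holomorphic_on ball 1 \<rho>" and F1: "F1 holomorphic_on ball 1 \<rho>"
    and F_F1: "\<And>v. v \<in> ball 1 \<rho> \<Longrightarrow> F v = F1 v * (v - 1)"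
    and R_F1: "\<And>v. v \<in> ball 1 \<rho> \<Longrightarrow> R v * F1 v = pmf_gf y v * (c * (\<Prod>i = 1..C - 1. (v - z i)))"
    and gf_R: "\<And>v. v \<in> ball 1 \<rho> \<Longrightarrow> norm v < 1 \<Longrightarrow> pmf_gf \<pi> v = R v"
    using that by (rule queue_gf_continuation[OF z])
  note R_F1 = R_F1[folded p_def]
  have moments: "integrable (measure_pmf \<pi>) (\<lambda>q. fact n * real (q choose n))"
    "(deriv ^^ n) R 1 = of_real (measure_pmf.expectation \<pi> (\<lambda>q. fact n * real (q choose n)))" for n
    by (rule factorial_moment_continuation[OF \<rho> R gf_R]; assumption)+
  have cm: "measure_pmf.expectation \<pi> (\<lambda>q. fact 2 * real (q choose 2)) =
      measure_pmf.variance \<pi> real + measure_pmf.expectation \<pi> real ^ 2 - measure_pmf.expectation \<pi> real"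
    by (rule central_moments_via_factorial_moments(2)[OF moments(1)])
  have i1: "integrable (measure_pmf \<pi>) real"
    using moments(1)[of 1] by (simp only: fact_times_choose_real)
  have i2: "integrable (measure_pmf \<pi>) (\<lambda>q. real q * (real q - 1))"
    using moments(1)[of 2] by (simp only: fact_times_choose_real)
  show "integrable (measure_pmf \<pi>) real" by (rule i1)
  show "integrable (measure_pmf \<pi>) (\<lambda>q. (real q)\<^sup>2)"
    using Bochner_Integration.integrable_add[OF i2 i1] by (simp add: algebra_simps power2_eq_square)
  have one: "1 \<in> ball (1::complex) \<rho>" using \<rho> by simp
  have hp: "p holomorphic_on ball 1 \<rho>" unfolding p_def by (intro holomorphic_intros)
  have hcp: "(\<lambda>v. c * p v) holomorphic_on ball 1 \<rho>" by (intro holomorphic_intros hp)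
  have hy: "pmf_gf y holomorphic_on ball 1 \<rho>"
    using pmf_gf_holomorphic_y sub by (rule holomorphic_on_subset)
  have hF: "F holomorphic_on ball 1 \<rho>"
    using F_holomorphic sub by (rule holomorphic_on_subset)
  have hlin: "(\<lambda>v::complex. v - 1) holomorphic_on ball 1 \<rho>" by (intro holomorphic_intros)
  have dlin: "deriv (\<lambda>v::complex. v - 1) = (\<lambda>_. 1)"
    by (rule ext, rule DERIV_imp_deriv) (auto intro!: derivative_eq_intros)
  \<comment> \<open>At 1 only the first derivative of \<open>v - 1\<close> is nonzero, so the n-th
    derivative of \<open>F\<close> is n times the derivative of order n - 1 of \<open>F1\<close>;
    this gives the divisors 2 and 3 below.\<close>
  have DF: "(deriv ^^ n) F 1 = (\<Sum>i = 0..n. of_nat (n choose i) * (deriv ^^ i) F1 1 * (deriv ^^ (n - i)) (\<lambda>v. v - 1) 1)" for n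
    unfolding higher_deriv_mult[OF F1 hlin open_ball one, symmetric]
    by (rule higher_deriv_transform_within_open[OF hF _ open_ball one])
       (auto intro!: holomorphic_intros F1 F_F1)
  have f1: "F1 1 = of_real drift"
    using DF[of 1] by (simp add: dlin deriv_F_1)
  have f2: "deriv F1 1 = (deriv ^^ 2) F 1 / 2"
    using DF[of 2] by (simp add: dlin numeral_2_eq_2)
  have f3: "(deriv ^^ 2) F1 1 = (deriv ^^ 3) F 1 / 3"
    using DF[of 3] by (simp add: dlin numeral_2_eq_2 numeral_3_eq_3)
  have p1: "deriv p 1 = p 1 * \<sigma>1" "(deriv ^^ 2) p 1 = p 1 * (\<sigma>1\<^sup>2 - \<sigma>2)"
    using higher_deriv_prod_linear[of "{1..C - 1}" z 1, OF finite_atLeastAtMost ne]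
    unfolding p_def[abs_def] \<sigma>1_def \<sigma>2_def by simp_all
  have Dp: "deriv (\<lambda>v. c * p v) 1 = c * deriv p 1" "(deriv ^^ 2) (\<lambda>v. c * p v) 1 = c * (deriv ^^ 2) p 1"
    using higher_deriv_cmult[OF hp one open_ball, of 1 c] higher_deriv_cmult[OF hp one open_ball, of 2 c]
    by simp_all
  have DR: "(\<Sum>i = 0..n. of_nat (n choose i) * (deriv ^^ i) R 1 * (deriv ^^ (n - i)) F1 1) =
      (\<Sum>i = 0..n. of_nat (n choose i) * (deriv ^^ i) (pmf_gf y) 1 * (deriv ^^ (n - i)) (\<lambda>v. c * p v) 1)" for n
    unfolding higher_deriv_mult[OF R F1 open_ball one, symmetric]
      higher_deriv_mult[OF hy hcp open_ball one, symmetric]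
    by (rule higher_deriv_transform_within_open[OF _ _ open_ball one])
       (auto intro!: holomorphic_intros R F1 hy hp R_F1)
  note dy = pmf_gf_derivs_at_1[OF r, folded Y1_def, folded Y2_def Y3_def]
  have "R 1 = 1" using moments(2)[of 0] by simp
  \<comment> \<open>Total probability 1 determines \<open>c\<close> without knowledge of the
    boundary probabilities.\<close>
  then have cp: "c * p 1 = of_real drift" using R_F1[OF one] f1 by simp
  define R1 where "R1 = deriv R 1"
  define R2 where "R2 = (deriv ^^ 2) R 1"
  have E1: "R1 * of_real drift + (deriv ^^ 2) F 1 / 2 = of_real drift * (of_real Y1 + \<sigma>1)"
    using DR[of 1] \<open>R 1 = 1\<close> f1 f2 p1(1) Dp(1) dy(1)
    by (simp add: R1_def cp[symmetric] algebra_simps)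
  have "R2 * F1 1 + 2 * R1 * deriv F1 1 + (deriv ^^ 2) F1 1 =
      (deriv ^^ 2) (pmf_gf y) 1 * (c * p 1) + 2 * deriv (pmf_gf y) 1 * (c * deriv p 1) + c * (deriv ^^ 2) p 1"
    using DR[of 2] \<open>R 1 = 1\<close> Dp by (simp add: R1_def R2_def numeral_2_eq_2 algebra_simps)
  then have E2: "R2 * of_real drift + R1 * (deriv ^^ 2) F 1 + (deriv ^^ 3) F 1 / 3 =
      of_real drift * (of_real Y2 + of_real Y1 ^ 2 - of_real Y1 + 2 * of_real Y1 * \<sigma>1 + \<sigma>1 ^ 2 - \<sigma>2)"
    unfolding f1 f2 f3 p1 dy cp[symmetric] by (simp add: algebra_simps)
  have drift: "complex_of_real drift = of_real S1 - of_real Y1" "complex_of_real drift \<noteq> 0"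
    using drift_pos by (simp_all add: drift_def S1_def Y1_def)
  note dF = F_derivs_at_1[folded S1_def Y1_def, folded S2_def S3_def Y2_def Y3_def]
  have F2: "(deriv ^^ 2) F 1 = of_nat C ^ 2 - of_nat C - (of_real Y2 + of_real Y1 ^ 2 - of_real Y1 +
      2 * of_real Y1 * (of_nat C - of_real S1) +
      (of_real S2 + (of_nat C - of_real S1) ^ 2 - (of_nat C - of_real S1)))"
    unfolding dF(1) by simp
  have F3: "(deriv ^^ 3) F 1 = of_nat C ^ 3 - 3 * of_nat C ^ 2 + 2 * of_nat C -
      (of_real Y3 + 3 * of_real Y1 * of_real Y2 + of_real Y1 ^ 3 - 3 * (of_real Y2 + of_real Y1 ^ 2) + 2 * of_real Y1
       + 3 * (of_real Y2 + of_real Y1 ^ 2 - of_real Y1) * (of_nat C - of_real S1)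
       + 3 * of_real Y1 * (of_real S2 + (of_nat C - of_real S1) ^ 2 - (of_nat C - of_real S1))
       + (- of_real S3 + 3 * (of_nat C - of_real S1) * of_real S2 + (of_nat C - of_real S1) ^ 3
          - 3 * (of_real S2 + (of_nat C - of_real S1) ^ 2) + 2 * (of_nat C - of_real S1)))"
    unfolding dF(2) by simp
  have EQ: "complex_of_real (measure_pmf.expectation \<pi> real) = R1"
    using moments(2)[of 1] by (simp add: R1_def)
  show "complex_of_real (measure_pmf.expectation \<pi> real) =
      complex_of_real ((S2 + Y2 + (S1 - Y1) * (1 + 2 * (S1 - real C)) - (S1 - Y1)\<^sup>2) / (2 * (S1 - Y1)))
      + (\<Sum>i = 1..C - 1. 1 / (1 - z i))"
    unfolding EQ \<sigma>1_def[symmetric] mean_from_derivs[OF drift F2 E1] by simp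
  have "complex_of_real (measure_pmf.variance \<pi> real) = R2 + R1 - R1 ^ 2"
    unfolding R2_def moments(2)[of 2] EQ[symmetric] cm by simp
  \<comment> \<open>Splitting z / (1 - z)^2 = 1 / (1 - z)^2 - 1 / (1 - z) merges the two root sums
    into the one displayed.\<close>
  moreover have "(\<Sum>i = 1..C - 1. z i / (1 - z i)\<^sup>2) = \<sigma>2 - \<sigma>1"
    unfolding \<sigma>1_def \<sigma>2_def sum_subtractf[symmetric]
  proof (intro sum.cong refl)
    fix i assume "i \<in> {1..C - 1}"
    then have "1 - z i \<noteq> 0" using ne by force
    then show "z i / (1 - z i)\<^sup>2 = 1 / (1 - z i)\<^sup>2 - 1 / (1 - z i)"
      by (simp add: divide_simps power2_eq_square)
  qed
  ultimately show "complex_of_real (measure_pmf.variance \<pi> real) =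
      complex_of_real (1 / (12 * (S1 - Y1)\<^sup>2) *
        (- 4 * (S3 - Y3) * (S1 - Y1) + 3 * (S2 + Y2)\<^sup>2
         - (6 * (S2 - Y2) - 1) * (S1 - Y1)\<^sup>2 - (S1 - Y1) ^ 4))
      - (\<Sum>i = 1..C - 1. z i / (1 - z i)\<^sup>2)"
    using variance_from_derivs[OF drift F2 F3 E1 E2] by simp
qed

end

section \<open>The station model\<close>

context station_queue
begin

definition arrivals_pmf :: "nat pmf" where
  "arrivals_pmf = embed_pmf (\<lambda>k. prob {\<omega> \<in> space M. Y 0 \<omega> = k})"

lemma measure_arrivals_pmf: "measure_pmf arrivals_pmf = distr M (count_space UNIV) (Y 0)"
  and pmf_arrivals_pmf: "pmf arrivals_pmf k = prob {\<omega> \<in> space M. Y 0 \<omega> = k}"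
proof -
  have vimage: "Y 0 -` {k} \<inter> space M = {\<omega> \<in> space M. Y 0 \<omega> = k}" for k by auto
  interpret D: prob_space "distr M (count_space UNIV) (Y 0)"
    by (rule prob_space_distr[OF Y_measurable])
  have e: "emeasure (distr M (count_space UNIV) (Y 0)) {k} = ennreal (prob {\<omega> \<in> space M. Y 0 \<omega> = k})" for k
    using Y_measurable[of 0] by (simp add: emeasure_distr vimage emeasure_eq_measure)
  have "(\<integral>\<^sup>+k. ennreal (prob {\<omega> \<in> space M. Y 0 \<omega> = k}) \<partial>count_space UNIV) =
      (\<integral>\<^sup>+k. emeasure (distr M (count_space UNIV) (Y 0)) {k} \<partial>count_space UNIV)"
    by (simp add: e)
  also have "\<dots> = emeasure (distr M (count_space UNIV) (Y 0)) UNIV"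
    by (subst emeasure_countable_singleton[symmetric]) auto
  also have "\<dots> = 1" using D.emeasure_space_1 by simp
  finally have "(\<integral>\<^sup>+k. ennreal (prob {\<omega> \<in> space M. Y 0 \<omega> = k}) \<partial>count_space UNIV) = 1" .
  then show p: "pmf arrivals_pmf k = prob {\<omega> \<in> space M. Y 0 \<omega> = k}" for k
    unfolding arrivals_pmf_def by (intro pmf_embed_pmf) auto
  show "measure_pmf arrivals_pmf = distr M (count_space UNIV) (Y 0)"
    by (rule measure_eqI_countable[of _ UNIV]) (simp_all add: e emeasure_pmf_single p)
qed

lemma pgf_Y: "pgf M (Y 0) = pmf_gf arrivals_pmf"
  by (simp add: fun_eq_iff pgf_def pmf_gf_def pmf_arrivals_pmf)

lemma integral_Y: "(\<integral>\<omega>. f (Y 0 \<omega>) \<partial>M) = measure_pmf.expectation arrivals_pmf f"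
  for f :: "nat \<Rightarrow> real"
  unfolding measure_arrivals_pmf using Y_measurable[of 0] by (subst integral_distr) auto

lemma integral_S: "(\<integral>\<omega>. f (S 0 \<omega>) \<partial>M) = measure_pmf.expectation s f"
  for f :: "nat \<Rightarrow> real"
  unfolding S_law[of 0, symmetric] using S_measurable[of 0] by (subst integral_distr) auto

lemma S_Y_measurable: "(\<lambda>\<omega>. (S 0 \<omega>, Y 0 \<omega>)) \<in> measurable M (count_space UNIV)"
proof -
  have "(\<lambda>\<omega>. (S 0 \<omega>, Y 0 \<omega>)) \<in> measurable M (count_space UNIV \<Otimes>\<^sub>M count_space UNIV)"
    by (intro measurable_Pair S_measurable Y_measurable)
  then show ?thesis by (simp add: pair_measure_countable)
qed

text \<open>On a countable space it suffices to compare singletons, and there the independence of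
  the sources supplies the product.\<close>

lemma joint_law:
  "measure_pmf (pair_pmf s arrivals_pmf) = distr M (count_space UNIV) (\<lambda>\<omega>. (S 0 \<omega>, Y 0 \<omega>))"
proof (rule measure_eqI_countable[of _ UNIV])
  fix w :: "nat \<times> nat"
  obtain u k where w: "w = (u, k)" by (cases w)
  define A where "A i = (if i = Space 0 then {\<omega> \<in> space M. S 0 \<omega> = u} else {\<omega> \<in> space M. Y 0 \<omega> = k})" for i
  have A: "A i \<in> source_events M S H Y Q i" if "i \<in> {Space 0, Arrivals 0}" for i
  proof -
    \<comment> \<open>The arrival source is generated by headway and count jointly, so an event
      about the count alone is a cylinder over all headways.\<close>
    have eq: "A (Space 0) = S 0 -` {u} \<inter> space M"
      "A (Arrivals 0) = (\<lambda>\<omega>. (H 0 \<omega>, Y 0 \<omega>)) -` (UNIV \<times> {k}) \<inter> space M"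
      by (auto simp: A_def)
    have "UNIV \<times> {k} \<in> sets (borel \<Otimes>\<^sub>M count_space (UNIV :: nat set))"
      by (rule pair_measureI) auto
    then have "A (Arrivals 0) \<in> source_events M S H Y Q (Arrivals 0)"
      unfolding eq source_events_def source.case by blast
    moreover have "A (Space 0) \<in> source_events M S H Y Q (Space 0)"
      unfolding eq source_events_def source.case by (rule CollectI, intro exI[of _ "{u}"]) simp
    ultimately show ?thesis using that by auto
  qed
  have "prob (\<Inter>i\<in>{Space 0, Arrivals 0}. A i) = (\<Prod>i\<in>{Space 0, Arrivals 0}. prob (A i))"
    by (rule indep_setsD[OF independence]) (use A in auto)
  then have "prob {\<omega> \<in> space M. S 0 \<omega> = u \<and> Y 0 \<omega> = k} =
      prob {\<omega> \<in> space M. S 0 \<omega> = u} * prob {\<omega> \<in> space M. Y 0 \<omega> = k}"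
    by (simp add: A_def Int_def conj_ac cong: conj_cong)
  moreover have "prob {\<omega> \<in> space M. S 0 \<omega> = u} = pmf s u"
  proof -
    have "pmf s u = measure (distr M (count_space UNIV) (S 0)) {u}"
      by (simp add: S_law pmf.rep_eq)
    also have "\<dots> = prob (S 0 -` {u} \<inter> space M)"
      using S_measurable[of 0] by (intro measure_distr) auto
    also have "S 0 -` {u} \<inter> space M = {\<omega> \<in> space M. S 0 \<omega> = u}" by auto
    finally show ?thesis ..
  qed
  ultimately have "pmf (pair_pmf s arrivals_pmf) w = prob {\<omega> \<in> space M. S 0 \<omega> = u \<and> Y 0 \<omega> = k}"
    by (simp add: w pmf_pair pmf_arrivals_pmf)
  also have "{\<omega> \<in> space M. S 0 \<omega> = u \<and> Y 0 \<omega> = k} = (\<lambda>\<omega>. (S 0 \<omega>, Y 0 \<omega>)) -` {w} \<inter> space M"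
    by (auto simp: w)
  finally show "emeasure (measure_pmf (pair_pmf s arrivals_pmf)) {w} =
      emeasure (distr M (count_space UNIV) (\<lambda>\<omega>. (S 0 \<omega>, Y 0 \<omega>))) {w}"
    using S_Y_measurable by (simp add: emeasure_pmf_single emeasure_distr emeasure_eq_measure)
qed auto

definition step_pmf :: "nat \<Rightarrow> nat pmf" where
  "step_pmf q = bind_pmf s (\<lambda>u. map_pmf (\<lambda>k. q - u + k) arrivals_pmf)"

lemma queue_transition_eq: "queue_transition M S Y q k = pmf (step_pmf q) k"
proof -
  have "step_pmf q = map_pmf (\<lambda>(u, k). q - u + k) (pair_pmf s arrivals_pmf)"
    by (simp add: step_pmf_def pair_pmf_def map_bind_pmf map_pmf_def bind_assoc_pmf bind_return_pmf)
  then have "pmf (step_pmf q) k =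
      measure (distr M (count_space UNIV) (\<lambda>\<omega>. (S 0 \<omega>, Y 0 \<omega>))) ((\<lambda>(u, k). q - u + k) -` {k})"
    by (simp add: pmf_map joint_law)
  also have "\<dots> = prob ((\<lambda>\<omega>. (S 0 \<omega>, Y 0 \<omega>)) -` ((\<lambda>(u, k). q - u + k) -` {k}) \<inter> space M)"
    using S_Y_measurable by (intro measure_distr) auto
  also have "(\<lambda>\<omega>. (S 0 \<omega>, Y 0 \<omega>)) -` ((\<lambda>(u, k). q - u + k) -` {k}) \<inter> space M =
      {\<omega> \<in> space M. q - S 0 \<omega> + Y 0 \<omega> = k}"
    by auto
  finally show ?thesis by (simp add: queue_transition_def)
qed

lemma stationary_law_iff: "stationary_law M S Y \<pi> \<longleftrightarrow> \<pi> = bind_pmf \<pi> step_pmf"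
  unfolding stationary_law_def queue_transition_eq pmf_bind[symmetric] pmf_eq_iff ..

text \<open>With a frozen queue the point masses at 0 and 1 are two different stationary
  laws.\<close>

lemma stable_imp_moving:
  assumes "stable M S Y"
  shows "\<not> (s = return_pmf 0 \<and> arrivals_pmf = return_pmf 0)"
proof
  assume "s = return_pmf 0 \<and> arrivals_pmf = return_pmf 0"
  then have "step_pmf q = return_pmf q" for q
    by (subst step_pmf_def) (simp add: bind_return_pmf)
  then have "step_pmf = return_pmf" by (rule ext)
  then have "stationary_law M S Y \<pi>" for \<pi>
    by (simp add: stationary_law_iff bind_return_pmf')
  then have "return_pmf 0 = (return_pmf 1 :: nat pmf)"
    using assms unfolding stable_def by blast
  then show False by simp
qed

end

theorem proposition5:
  fixes M :: "'a measure"
    and N n C :: nat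
    and Hbar Fbar \<theta> \<gamma> :: real
    and T lam :: "nat \<Rightarrow> real"
    and s :: "nat \<Rightarrow> nat pmf"
    and hw :: "nat \<Rightarrow> real measure"
    and S Y Q :: "nat \<Rightarrow> nat \<Rightarrow> 'a \<Rightarrow> nat"
    and H :: "nat \<Rightarrow> nat \<Rightarrow> 'a \<Rightarrow> real"
    and \<pi> :: "nat pmf"
    and z :: "nat \<Rightarrow> complex"
  assumes station: "n \<in> {1..N}"
    and constants: "Hbar > 0" "Fbar > 0" "\<theta> > 0" "\<gamma> \<ge> 0" "\<forall>m\<in>{1..N}. T m > 0"
    and headway: "hw n = headway_law Hbar Fbar \<theta> \<gamma> (T n) (T N) \<or>
                  hw n = normal_headway_law Hbar Fbar \<theta> \<gamma> (T n) (T N)"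
    and queue: "station_queue M C (lam n) (s n) (hw n) (S n) (H n) (Y n) (Q n)"
    and stable: "stable M (S n) (Y n)"
    and steady_state: "stationary_law M (S n) (Y n) \<pi>"
    and roots: "lists_disk_roots (char_fun C (s n) (pgf M (Y n 0))) C z" "z 0 = 1"
  shows "let Sv = (\<lambda>\<omega>. real (S n 0 \<omega>)); Yv = (\<lambda>\<omega>. real (Y n 0 \<omega>));
             S1 = mean M Sv; S2 = central_moment M 2 Sv; S3 = central_moment M 3 Sv;
             Y1 = mean M Yv; Y2 = central_moment M 2 Yv; Y3 = central_moment M 3 Yv
         in integrable (measure_pmf \<pi>) (\<lambda>q. real q) \<and>
            integrable (measure_pmf \<pi>) (\<lambda>q. (real q)\<^sup>2) \<and>
            complex_of_real (measure_pmf.expectation \<pi> (\<lambda>q. real q)) =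
              complex_of_real
                ((S2 + Y2 + (S1 - Y1) * (1 + 2 * (S1 - real C)) - (S1 - Y1)\<^sup>2) / (2 * (S1 - Y1)))
              + (\<Sum>i = 1..C - 1. 1 / (1 - z i)) \<and>
            complex_of_real (measure_pmf.variance \<pi> (\<lambda>q. real q)) =
              complex_of_real
                (1 / (12 * (S1 - Y1)\<^sup>2) *
                  (- 4 * (S3 - Y3) * (S1 - Y1) + 3 * (S2 + Y2)\<^sup>2
                   - (6 * (S2 - Y2) - 1) * (S1 - Y1)\<^sup>2 - (S1 - Y1) ^ 4))
              - (\<Sum>i = 1..C - 1. z i / (1 - z i)\<^sup>2)"
proof -
  interpret station_queue M C "lam n" "s n" "hw n" "S n" "H n" "Y n" "Q n"
    by (rule queue)
  have T: "0 < T n" using constants(5) station by blast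
  obtain \<epsilon> where \<epsilon>: "0 < \<epsilon>" "(\<integral>\<^sup>+x. ennreal (exp (\<epsilon> * x)) \<partial>hw n) < \<infinity>"
    using headway_exp_moment[OF constants(3,4) T headway] by blast
  note hw = headway_nonneg[OF headway]
  obtain r where r: "1 < r" "summable (\<lambda>k. prob {\<omega> \<in> space M. Y n 0 \<omega> = k} * r ^ k)"
    using Y_exp_moment[OF hw(2,1) \<epsilon>] by blast
  interpret bulk_queue "s n" arrivals_pmf \<pi> C r
  proof
    show "0 < pmf arrivals_pmf 0"
      using prob_no_arrivals_pos[OF hw(2,1)] by (simp add: pmf_arrivals_pmf)
    show "\<pi> = bind_pmf \<pi> (\<lambda>q. bind_pmf (s n) (\<lambda>u. map_pmf (\<lambda>k. q - u + k) arrivals_pmf))"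
      using steady_state unfolding stationary_law_iff step_pmf_def[abs_def] .
    show "\<not> (s n = return_pmf 0 \<and> arrivals_pmf = return_pmf 0)"
      by (rule stable_imp_moving[OF stable])
  qed (use capacity space_range r in \<open>simp_all add: pmf_arrivals_pmf\<close>)
  have "lists_disk_roots F C z"
    using roots(1) by (simp add: F_def pgf_Y)
  note * = queue_moments[OF this roots(2)]
  show ?thesis
    \<comment> \<open>The rules are instantiated for an arbitrary centre \<open>a\<close> and
      exponent \<open>b\<close>, so the means nested in the central moments are covered as
      well.\<close>
    unfolding Let_def mean_def central_moment_def
      integral_Y[of real] integral_S[of real]
      integral_Y[of "\<lambda>k. (real k - a) ^ b" for a b] integral_S[of "\<lambda>k. (real k - a) ^ b" for a b]
    using * by blast
qed

end
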